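(* Let $\mathbb{K}$ be an infinite field and $n$ a positive integer. (i) Let $S$ be a $\mathbb{K}$-algebra, $C\subset Z(S)$ a subalgebra of its center, and $\mathrm{tr}:S\to C$ a trace which commutes with all derivations $\partial$ of $S$ such that $\partial(C)\subseteq C$. Then $\partial(MD_n(S/C))\subseteq MD_n(S/C)$ for all derivations $\partial$ of $S$ such that $\partial(C)\subseteq C$. (ii) Let $R$ be a $\mathbb{K}[q^{\pm1}]$-algebra and $\epsilon\in\mathbb{K}^\times$ be such that $q-\epsilon\in R$ is regular (not a zero divisor). Assume that $C_\epsilon$ is a Poisson subalgebra of the center of $R_\epsilon:=R/(q-\epsilon)R$ and that $R_\epsilon$ is equipped with a trace $\mathrm{tr}:R_\epsilon\to C_\epsilon$ which commutes with all derivations $\partial$ of $R_\epsilon$ such that $\partial(C_\epsilon)\subseteq C_\epsilon$. Then the modified discriminant ideal $MD_n(R_\epsilon/C_\epsilon)$ is a Poisson ideal of $C_\epsilon$ with respect to the induced Poisson structure on $C_\epsilon$. Moreover, $\partial(MD_n(R_\epsilon/C_\epsilon))\subseteq MD_n(R_\epsilon/C_\epsilon)$ for all derivations $\partial$ of $R_\epsilon$ such that $\partial(C_\epsilon)\subseteq C_\epsilon$.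
   Context: All algebras are unital; derivations are $\mathbb{K}$-linear. A trace $\mathrm{tr}:S\to C$, for $C$ a subalgebra of the center $Z(S)$, is a $C$-linear map with $\mathrm{tr}(xy)=\mathrm{tr}(yx)$; it commutes with $\partial$ if $\mathrm{tr}(\partial x)=\partial(\mathrm{tr}(x))$ for all $x\in S$. The $n$-th modified discriminant ideal $MD_n(S/C)$ is the ideal of $C$ generated by $\det([\mathrm{tr}(x_iy_j)]_{i,j=1}^n)$ for all $(x_1,\dots,x_n),(y_1,\dots,y_n)\in S^n$. Poisson structure: with $\sigma:R\to R_\epsilon$ the projection, $Z(R_\epsilon)$ is a Poisson algebra with $\{z_1,z_2\}:=\sigma\big(\tfrac{x_1x_2-x_2x_1}{q-\epsilon}\big)$ for any $x_i\in\sigma^{-1}(z_i)$ (well defined). An ideal $I$ of a Poisson algebra $C$ is Poisson if $\{I,C\}\subseteq I$. *)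

theory Defs
  imports "HOL-Algebra.QuotRing" "HOL-Algebra.Module" "HOL-Algebra.Subrings"
    "HOL-Combinatorics.Permutations"
begin

section \<open>Unital associative algebras over a commutative ring\<close>

text \<open>The locale \<^locale>\<open>algebra\<close> of HOL-Algebra only covers commutative algebras.\<close>

locale assoc_algebra = module R M + M: ring M for R (structure) and M (structure) +
  assumes smult_mult_left:
      "\<lbrakk>a \<in> carrier R; x \<in> carrier M; y \<in> carrier M\<rbrakk> \<Longrightarrow>
        (a \<odot>\<^bsub>M\<^esub> x) \<otimes>\<^bsub>M\<^esub> y = a \<odot>\<^bsub>M\<^esub> (x \<otimes>\<^bsub>M\<^esub> y)"
    and smult_mult_right:
      "\<lbrakk>a \<in> carrier R; x \<in> carrier M; y \<in> carrier M\<rbrakk> \<Longrightarrow>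
        x \<otimes>\<^bsub>M\<^esub> (a \<odot>\<^bsub>M\<^esub> y) = a \<odot>\<^bsub>M\<^esub> (x \<otimes>\<^bsub>M\<^esub> y)"

definition ring_center :: "('a, 'm) ring_scheme \<Rightarrow> 'a set" where
  "ring_center R = {z \<in> carrier R. \<forall>x \<in> carrier R. z \<otimes>\<^bsub>R\<^esub> x = x \<otimes>\<^bsub>R\<^esub> z}"

definition center_algebra :: "('k, 'a, 'm) module_scheme \<Rightarrow> ('k, 'a, 'm) module_scheme" where
  "center_algebra S = S\<lparr>carrier := ring_center S\<rparr>"

definition unital_subalgebra ::
  "('k, 'l) ring_scheme \<Rightarrow> ('k, 'a, 'm) module_scheme \<Rightarrow> 'a set \<Rightarrow> bool" where
  "unital_subalgebra K A C \<longleftrightarrow>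
     subring C A \<and> (\<forall>c \<in> carrier K. \<forall>x \<in> C. c \<odot>\<^bsub>A\<^esub> x \<in> C)"

definition derivation ::
  "('k, 'l) ring_scheme \<Rightarrow> ('k, 'a, 'm) module_scheme \<Rightarrow> ('a \<Rightarrow> 'a) \<Rightarrow> bool" where
  "derivation K S \<delta> \<longleftrightarrow>
     \<delta> \<in> carrier S \<rightarrow> carrier S \<and>
     (\<forall>x \<in> carrier S. \<forall>y \<in> carrier S. \<delta> (x \<oplus>\<^bsub>S\<^esub> y) = \<delta> x \<oplus>\<^bsub>S\<^esub> \<delta> y) \<and>
     (\<forall>c \<in> carrier K. \<forall>x \<in> carrier S. \<delta> (c \<odot>\<^bsub>S\<^esub> x) = c \<odot>\<^bsub>S\<^esub> \<delta> x) \<and>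
     (\<forall>x \<in> carrier S. \<forall>y \<in> carrier S.
        \<delta> (x \<otimes>\<^bsub>S\<^esub> y) = (\<delta> x \<otimes>\<^bsub>S\<^esub> y) \<oplus>\<^bsub>S\<^esub> (x \<otimes>\<^bsub>S\<^esub> \<delta> y))"

definition algebra_trace ::
  "('a, 'm) ring_scheme \<Rightarrow> 'a set \<Rightarrow> ('a \<Rightarrow> 'a) \<Rightarrow> bool" where
  "algebra_trace S C tr \<longleftrightarrow>
     tr \<in> carrier S \<rightarrow> C \<and>
     (\<forall>x \<in> carrier S. \<forall>y \<in> carrier S. tr (x \<oplus>\<^bsub>S\<^esub> y) = tr x \<oplus>\<^bsub>S\<^esub> tr y) \<and>
     (\<forall>c \<in> C. \<forall>x \<in> carrier S. tr (c \<otimes>\<^bsub>S\<^esub> x) = c \<otimes>\<^bsub>S\<^esub> tr x) \<and>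
     (\<forall>x \<in> carrier S. \<forall>y \<in> carrier S. tr (x \<otimes>\<^bsub>S\<^esub> y) = tr (y \<otimes>\<^bsub>S\<^esub> x))"

definition trace_commutes_with ::
  "('a, 'm) ring_scheme \<Rightarrow> ('a \<Rightarrow> 'a) \<Rightarrow> ('a \<Rightarrow> 'a) \<Rightarrow> bool" where
  "trace_commutes_with S tr \<delta> \<longleftrightarrow> (\<forall>x \<in> carrier S. tr (\<delta> x) = \<delta> (tr x))"

section \<open>Modified discriminant ideals\<close>

text \<open>The Leibniz formula, in a carrier-based commutative ring.\<close>

definition ring_det :: "('a, 'm) ring_scheme \<Rightarrow> nat \<Rightarrow> (nat \<Rightarrow> nat \<Rightarrow> 'a) \<Rightarrow> 'a" where
  "ring_det C n M =
     (\<Oplus>\<^bsub>C\<^esub>p \<in> {p. p permutes {1..n}}.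
        if evenperm p then (\<Otimes>\<^bsub>C\<^esub>i \<in> {1..n}. M i (p i))
        else \<ominus>\<^bsub>C\<^esub> (\<Otimes>\<^bsub>C\<^esub>i \<in> {1..n}. M i (p i)))"

definition modified_discriminant_ideal ::
  "('a, 'm) ring_scheme \<Rightarrow> 'a set \<Rightarrow> ('a \<Rightarrow> 'a) \<Rightarrow> nat \<Rightarrow> 'a set" where
  "modified_discriminant_ideal S C tr n =
     Idl\<^bsub>S\<lparr>carrier := C\<rparr>\<^esub>
       {ring_det (S\<lparr>carrier := C\<rparr>) n (\<lambda>i j. tr (x i \<otimes>\<^bsub>S\<^esub> y j)) | x y.
          x \<in> {1..n} \<rightarrow> carrier S \<and> y \<in> {1..n} \<rightarrow> carrier S}"

section \<open>Laurent polynomials\<close>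

text \<open>An element is its family of coefficients, \<open>f i\<close> being the coefficient of \<open>q\<close> to the
  power \<open>i\<close>; multiplication is convolution.\<close>

definition laurent :: "('k, 'l) ring_scheme \<Rightarrow> (int \<Rightarrow> 'k) ring" where
  "laurent K =
     \<lparr>carrier = {f. (\<forall>i. f i \<in> carrier K) \<and> finite {i. f i \<noteq> \<zero>\<^bsub>K\<^esub>}},
      monoid.mult = (\<lambda>f g n. \<Oplus>\<^bsub>K\<^esub>i \<in> {i. f i \<noteq> \<zero>\<^bsub>K\<^esub>}. f i \<otimes>\<^bsub>K\<^esub> g (n - i)),
      one = (\<lambda>i. if i = 0 then \<one>\<^bsub>K\<^esub> else \<zero>\<^bsub>K\<^esub>),
      ring.zero = (\<lambda>i. \<zero>\<^bsub>K\<^esub>),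
      add = (\<lambda>f g i. f i \<oplus>\<^bsub>K\<^esub> g i)\<rparr>"

definition laurent_const :: "('k, 'l) ring_scheme \<Rightarrow> 'k \<Rightarrow> int \<Rightarrow> 'k" where
  "laurent_const K c = (\<lambda>i. if i = 0 then c else \<zero>\<^bsub>K\<^esub>)"

definition laurent_var :: "('k, 'l) ring_scheme \<Rightarrow> int \<Rightarrow> 'k" where
  "laurent_var K = (\<lambda>i. if i = 1 then \<one>\<^bsub>K\<^esub> else \<zero>\<^bsub>K\<^esub>)"

lemma (in abelian_monoid) finsum_swap:
  assumes "finite A" "finite B" "\<And>i j. i \<in> A \<Longrightarrow> j \<in> B \<Longrightarrow> f i j \<in> carrier G"
  shows "(\<Oplus>i\<in>A. \<Oplus>j\<in>B. f i j) = (\<Oplus>j\<in>B. \<Oplus>i\<in>A. f i j)"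
  using assms(1,3)
proof (induction A)
  case empty
  then show ?case by (simp add: finsum_zero)
next
  case (insert x A)
  have "(\<Oplus>i\<in>insert x A. \<Oplus>j\<in>B. f i j) = (\<Oplus>j\<in>B. f x j) \<oplus> (\<Oplus>j\<in>B. \<Oplus>i\<in>A. f i j)"
    using insert by (subst finsum_insert) (auto intro!: finsum_closed)
  also have "\<dots> = (\<Oplus>j\<in>B. f x j \<oplus> (\<Oplus>i\<in>A. f i j))"
    using insert by (subst finsum_addf) (auto intro!: finsum_closed)
  also have "\<dots> = (\<Oplus>j\<in>B. \<Oplus>i\<in>insert x A. f i j)"
    using insert by (intro finsum_cong') (auto intro!: finsum_closed)
  finally show ?case .
qed

lemma laurent_simps:
  "carrier (laurent K) = {f. (\<forall>i. f i \<in> carrier K) \<and> finite {i. f i \<noteq> \<zero>\<^bsub>K\<^esub>}}"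
  "(f \<otimes>\<^bsub>laurent K\<^esub> g) = (\<lambda>n. \<Oplus>\<^bsub>K\<^esub>i \<in> {i. f i \<noteq> \<zero>\<^bsub>K\<^esub>}. f i \<otimes>\<^bsub>K\<^esub> g (n - i))"
  "\<one>\<^bsub>laurent K\<^esub> = (\<lambda>i. if i = 0 then \<one>\<^bsub>K\<^esub> else \<zero>\<^bsub>K\<^esub>)"
  "\<zero>\<^bsub>laurent K\<^esub> = (\<lambda>i. \<zero>\<^bsub>K\<^esub>)"
  "f \<oplus>\<^bsub>laurent K\<^esub> g = (\<lambda>i. f i \<oplus>\<^bsub>K\<^esub> g i)"
  by (simp_all add: laurent_def)

context cring
begin

lemma laurent_mult_eq:
  assumes f: "f \<in> carrier (laurent R)" and g: "g \<in> carrier (laurent R)"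
    and A: "finite A" "{i. f i \<noteq> \<zero>} \<subseteq> A"
  shows "(f \<otimes>\<^bsub>laurent R\<^esub> g) n = (\<Oplus>i\<in>A. f i \<otimes> g (n - i))"
  unfolding laurent_simps
  by (rule add.finprod_mono_neutral_cong_left) (use assms in \<open>auto simp: laurent_simps\<close>)

lemma laurent_mult_closed:
  assumes f: "f \<in> carrier (laurent R)" and g: "g \<in> carrier (laurent R)"
  shows "f \<otimes>\<^bsub>laurent R\<^esub> g \<in> carrier (laurent R)"
proof -
  let ?F = "{i. f i \<noteq> \<zero>}" and ?G = "{i. g i \<noteq> \<zero>}"
  have "{n. (f \<otimes>\<^bsub>laurent R\<^esub> g) n \<noteq> \<zero>} \<subseteq> (\<lambda>(i, j). i + j) ` (?F \<times> ?G)"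
  proof
    fix n assume n: "n \<in> {n. (f \<otimes>\<^bsub>laurent R\<^esub> g) n \<noteq> \<zero>}"
    have "\<exists>i \<in> ?F. g (n - i) \<noteq> \<zero>"
    proof (rule ccontr)
      assume "\<not> ?thesis"
      then have "(f \<otimes>\<^bsub>laurent R\<^esub> g) n = \<zero>"
        unfolding laurent_simps
        by (intro add.finprod_one_eqI) (use f in \<open>auto simp: laurent_simps\<close>)
      with n show False by simp
    qed
    then obtain i where "i \<in> ?F" "g (n - i) \<noteq> \<zero>" by blast
    then show "n \<in> (\<lambda>(i, j). i + j) ` (?F \<times> ?G)"
      by (intro image_eqI[of _ _ "(i, n - i)"]) auto
  qed
  moreover have "finite ((\<lambda>(i, j). i + j) ` (?F \<times> ?G))"
    using f g by (auto simp: laurent_simps)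
  moreover have "(f \<otimes>\<^bsub>laurent R\<^esub> g) n \<in> carrier R" for n
    unfolding laurent_simps
    by (intro finsum_closed) (use f g in \<open>auto simp: laurent_simps\<close>)
  ultimately show ?thesis
    using finite_subset by (auto simp: laurent_simps(1))
qed

lemma laurent_mult_comm:
  assumes f: "f \<in> carrier (laurent R)" and g: "g \<in> carrier (laurent R)"
  shows "f \<otimes>\<^bsub>laurent R\<^esub> g = g \<otimes>\<^bsub>laurent R\<^esub> f"
proof
  fix n
  let ?A = "{i. f i \<noteq> \<zero>} \<union> (\<lambda>j. n - j) ` {j. g j \<noteq> \<zero>}"
  have fin: "finite ?A" using f g by (auto simp: laurent_simps)
  have car: "\<And>i. f i \<in> carrier R" "\<And>i. g i \<in> carrier R" using f g by (auto simp: laurent_simps)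
  have sub: "{i. g i \<noteq> \<zero>} \<subseteq> (\<lambda>i. n - i) ` ?A"
    by (auto simp: image_Un image_image)
  have "(g \<otimes>\<^bsub>laurent R\<^esub> f) n = (\<Oplus>i\<in>(\<lambda>i. n - i) ` ?A. g i \<otimes> f (n - i))"
    by (rule laurent_mult_eq[OF g f _ sub]) (use fin in auto)
  also have "\<dots> = (\<Oplus>i\<in>?A. g (n - i) \<otimes> f (n - (n - i)))"
    by (rule finsum_reindex) (use car in \<open>auto simp: inj_on_def\<close>)
  also have "\<dots> = (\<Oplus>i\<in>?A. f i \<otimes> g (n - i))"
    by (rule finsum_cong') (use car in \<open>auto simp: m_comm\<close>)
  also have "\<dots> = (f \<otimes>\<^bsub>laurent R\<^esub> g) n"
    by (rule laurent_mult_eq[symmetric, OF f g fin]) auto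
  finally show "(f \<otimes>\<^bsub>laurent R\<^esub> g) n = (g \<otimes>\<^bsub>laurent R\<^esub> f) n" by simp
qed

lemma laurent_mult_assoc:
  assumes f: "f \<in> carrier (laurent R)" and g: "g \<in> carrier (laurent R)"
    and h: "h \<in> carrier (laurent R)"
  shows "(f \<otimes>\<^bsub>laurent R\<^esub> g) \<otimes>\<^bsub>laurent R\<^esub> h = f \<otimes>\<^bsub>laurent R\<^esub> (g \<otimes>\<^bsub>laurent R\<^esub> h)"
proof
  fix n
  let ?F = "{i. f i \<noteq> \<zero>}" and ?G = "{i. g i \<noteq> \<zero>}"
  let ?A = "{k. (f \<otimes>\<^bsub>laurent R\<^esub> g) k \<noteq> \<zero>} \<union> (\<lambda>(i, j). i + j) ` (?F \<times> ?G)"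
  have fg: "f \<otimes>\<^bsub>laurent R\<^esub> g \<in> carrier (laurent R)" by (rule laurent_mult_closed[OF f g])
  have gh: "g \<otimes>\<^bsub>laurent R\<^esub> h \<in> carrier (laurent R)" by (rule laurent_mult_closed[OF g h])
  have finF: "finite ?F" and finG: "finite ?G" and fin: "finite ?A"
    using f g fg by (auto simp: laurent_simps(1))
  have car: "\<And>i. f i \<in> carrier R" "\<And>i. g i \<in> carrier R" "\<And>i. h i \<in> carrier R"
    using f g h by (auto simp: laurent_simps)
  have "((f \<otimes>\<^bsub>laurent R\<^esub> g) \<otimes>\<^bsub>laurent R\<^esub> h) n
      = (\<Oplus>k\<in>?A. (f \<otimes>\<^bsub>laurent R\<^esub> g) k \<otimes> h (n - k))"
    by (rule laurent_mult_eq[OF fg h fin]) auto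
  also have "\<dots> = (\<Oplus>k\<in>?A. \<Oplus>i\<in>?F. (f i \<otimes> g (k - i)) \<otimes> h (n - k))"
    unfolding laurent_mult_eq[OF f g finF subset_refl]
    by (intro finsum_cong' finsum_ldistr) (use car finF in \<open>auto intro!: finsum_closed\<close>)
  also have "\<dots> = (\<Oplus>i\<in>?F. \<Oplus>k\<in>?A. (f i \<otimes> g (k - i)) \<otimes> h (n - k))"
    by (rule finsum_swap[OF fin finF]) (use car in auto)
  also have "\<dots> = (\<Oplus>i\<in>?F. f i \<otimes> (g \<otimes>\<^bsub>laurent R\<^esub> h) (n - i))"
  proof (rule finsum_cong')
    fix i assume i: "i \<in> ?F"
    let ?B = "(\<lambda>k. k - i) ` ?A"
    have sub: "?G \<subseteq> ?B"
    proof
      fix j assume "j \<in> ?G"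
      with i have "i + j \<in> ?A" by auto
      then show "j \<in> ?B" by (intro image_eqI[of _ _ "i + j"]) auto
    qed
    have "(g \<otimes>\<^bsub>laurent R\<^esub> h) (n - i) = (\<Oplus>j\<in>?B. g j \<otimes> h (n - i - j))"
      by (rule laurent_mult_eq[OF g h _ sub]) (use fin in auto)
    also have "\<dots> = (\<Oplus>k\<in>?A. g (k - i) \<otimes> h (n - i - (k - i)))"
      by (rule finsum_reindex) (use car in \<open>auto simp: inj_on_def\<close>)
    finally have "f i \<otimes> (g \<otimes>\<^bsub>laurent R\<^esub> h) (n - i)
        = (\<Oplus>k\<in>?A. f i \<otimes> (g (k - i) \<otimes> h (n - i - (k - i))))"
      using car fin by (simp add: finsum_rdistr Pi_def)
    also have "\<dots> = (\<Oplus>k\<in>?A. (f i \<otimes> g (k - i)) \<otimes> h (n - k))"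
      by (rule finsum_cong') (use car in \<open>auto simp: m_assoc\<close>)
    finally show "(\<Oplus>k\<in>?A. (f i \<otimes> g (k - i)) \<otimes> h (n - k)) = f i \<otimes> (g \<otimes>\<^bsub>laurent R\<^esub> h) (n - i)"
      by simp
  qed (use car gh in \<open>auto simp: laurent_simps(1)\<close>)
  also have "\<dots> = (f \<otimes>\<^bsub>laurent R\<^esub> (g \<otimes>\<^bsub>laurent R\<^esub> h)) n"
    by (rule laurent_mult_eq[symmetric, OF f gh finF]) auto
  finally show "((f \<otimes>\<^bsub>laurent R\<^esub> g) \<otimes>\<^bsub>laurent R\<^esub> h) n = (f \<otimes>\<^bsub>laurent R\<^esub> (g \<otimes>\<^bsub>laurent R\<^esub> h)) n" .
qed

lemma laurent_const_closed:
  assumes "c \<in> carrier R"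
  shows "laurent_const R c \<in> carrier (laurent R)"
proof -
  have "{i. laurent_const R c i \<noteq> \<zero>} \<subseteq> {0}" by (auto simp: laurent_const_def)
  then show ?thesis
    using assms finite_subset by (fastforce simp: laurent_simps laurent_const_def)
qed

lemma laurent_var_closed: "laurent_var R \<in> carrier (laurent R)"
proof -
  have "{i. laurent_var R i \<noteq> \<zero>} \<subseteq> {1}" by (auto simp: laurent_var_def)
  then show ?thesis
    using finite_subset by (fastforce simp: laurent_simps laurent_var_def)
qed

lemma laurent_const_mult:
  assumes "c \<in> carrier R" "f \<in> carrier (laurent R)"
  shows "laurent_const R c \<otimes>\<^bsub>laurent R\<^esub> f = (\<lambda>i. c \<otimes> f i)"
proof
  fix n
  have "(laurent_const R c \<otimes>\<^bsub>laurent R\<^esub> f) n = (\<Oplus>i\<in>{0}. laurent_const R c i \<otimes> f (n - i))"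
    by (rule laurent_mult_eq) (use assms laurent_const_closed in \<open>auto simp: laurent_const_def\<close>)
  also have "\<dots> = c \<otimes> f n"
    using assms by (simp add: laurent_const_def laurent_simps)
  finally show "(laurent_const R c \<otimes>\<^bsub>laurent R\<^esub> f) n = c \<otimes> f n" .
qed

lemma laurent_const_one: "laurent_const R \<one> = \<one>\<^bsub>laurent R\<^esub>"
  by (simp add: laurent_const_def laurent_simps)

lemma laurent_cring: "cring (laurent R)"
proof (rule cringI)
  show "abelian_group (laurent R)"
  proof (rule abelian_groupI)
    fix f g assume fg: "f \<in> carrier (laurent R)" "g \<in> carrier (laurent R)"
    have "{i. f i \<oplus> g i \<noteq> \<zero>} \<subseteq> {i. f i \<noteq> \<zero>} \<union> {i. g i \<noteq> \<zero>}"
      using fg by (auto simp: laurent_simps)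
    then show "f \<oplus>\<^bsub>laurent R\<^esub> g \<in> carrier (laurent R)"
      using fg finite_subset by (fastforce simp: laurent_simps)
  next
    fix f assume f: "f \<in> carrier (laurent R)"
    have "{i. \<ominus> f i \<noteq> \<zero>} \<subseteq> {i. f i \<noteq> \<zero>}" using f by auto
    then have "(\<lambda>i. \<ominus> f i) \<in> carrier (laurent R)"
      using f finite_subset by (fastforce simp: laurent_simps)
    moreover have "(\<lambda>i. \<ominus> f i) \<oplus>\<^bsub>laurent R\<^esub> f = \<zero>\<^bsub>laurent R\<^esub>"
      using f by (auto simp: laurent_simps l_neg)
    ultimately show "\<exists>g\<in>carrier (laurent R). g \<oplus>\<^bsub>laurent R\<^esub> f = \<zero>\<^bsub>laurent R\<^esub>" by blast
  qed (auto simp: laurent_simps a_ac)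
next
  show "Group.comm_monoid (laurent R)"
  proof (rule comm_monoidI)
    fix f assume f: "f \<in> carrier (laurent R)"
    then show "\<one>\<^bsub>laurent R\<^esub> \<otimes>\<^bsub>laurent R\<^esub> f = f"
      unfolding laurent_const_one[symmetric]
      by (subst laurent_const_mult) (auto simp: laurent_simps)
  next
    show "\<one>\<^bsub>laurent R\<^esub> \<in> carrier (laurent R)"
      unfolding laurent_const_one[symmetric] by (rule laurent_const_closed) simp
  qed (use laurent_mult_closed laurent_mult_assoc laurent_mult_comm in auto)
next
  fix f g h
  assume f: "f \<in> carrier (laurent R)" and g: "g \<in> carrier (laurent R)"
    and h: "h \<in> carrier (laurent R)"
  show "(f \<oplus>\<^bsub>laurent R\<^esub> g) \<otimes>\<^bsub>laurent R\<^esub> h = f \<otimes>\<^bsub>laurent R\<^esub> h \<oplus>\<^bsub>laurent R\<^esub> g \<otimes>\<^bsub>laurent R\<^esub> h"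
  proof
    fix n
    let ?A = "{i. f i \<noteq> \<zero>} \<union> {i. g i \<noteq> \<zero>}"
    have fin: "finite ?A" using f g by (auto simp: laurent_simps)
    have car: "\<And>i. f i \<in> carrier R" "\<And>i. g i \<in> carrier R" "\<And>i. h i \<in> carrier R"
      using f g h by (auto simp: laurent_simps)
    have sub: "{i. (f \<oplus>\<^bsub>laurent R\<^esub> g) i \<noteq> \<zero>} \<subseteq> ?A"
      by (auto simp: laurent_simps)
    have fg: "f \<oplus>\<^bsub>laurent R\<^esub> g \<in> carrier (laurent R)"
      using finite_subset[OF sub fin] car by (auto simp: laurent_simps)
    have "((f \<oplus>\<^bsub>laurent R\<^esub> g) \<otimes>\<^bsub>laurent R\<^esub> h) n = (\<Oplus>i\<in>?A. (f i \<oplus> g i) \<otimes> h (n - i))"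
      using laurent_mult_eq[OF fg h fin sub] by (simp add: laurent_simps)
    also have "\<dots> = (\<Oplus>i\<in>?A. f i \<otimes> h (n - i) \<oplus> g i \<otimes> h (n - i))"
      by (rule finsum_cong') (use car in \<open>auto simp: l_distr\<close>)
    also have "\<dots> = (\<Oplus>i\<in>?A. f i \<otimes> h (n - i)) \<oplus> (\<Oplus>i\<in>?A. g i \<otimes> h (n - i))"
      by (rule finsum_addf) (use car in auto)
    also have "\<dots> = (f \<otimes>\<^bsub>laurent R\<^esub> h) n \<oplus> (g \<otimes>\<^bsub>laurent R\<^esub> h) n"
      using laurent_mult_eq[OF f h fin, of n] laurent_mult_eq[OF g h fin, of n] by simp
    finally show "((f \<oplus>\<^bsub>laurent R\<^esub> g) \<otimes>\<^bsub>laurent R\<^esub> h) n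
        = (f \<otimes>\<^bsub>laurent R\<^esub> h \<oplus>\<^bsub>laurent R\<^esub> g \<otimes>\<^bsub>laurent R\<^esub> h) n"
      by (simp add: laurent_simps(5))
  qed
qed

end

section \<open>Specialization and the induced Poisson bracket\<close>

text \<open>The element \<open>q - \<epsilon>\<close> of an algebra \<open>R\<close> over the Laurent polynomials.\<close>

definition q_minus :: "('k, 'l) ring_scheme \<Rightarrow> (int \<Rightarrow> 'k, 'r, 'm) module_scheme \<Rightarrow> 'k \<Rightarrow> 'r" where
  "q_minus K R \<epsilon> =
     (laurent_var K \<ominus>\<^bsub>laurent K\<^esub> laurent_const K \<epsilon>) \<odot>\<^bsub>R\<^esub> \<one>\<^bsub>R\<^esub>"

definition regular_element :: "('r, 'm) ring_scheme \<Rightarrow> 'r \<Rightarrow> bool" where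
  "regular_element R a \<longleftrightarrow>
     a \<in> carrier R \<and>
     (\<forall>x \<in> carrier R. a \<otimes>\<^bsub>R\<^esub> x = \<zero>\<^bsub>R\<^esub> \<longrightarrow> x = \<zero>\<^bsub>R\<^esub>) \<and>
     (\<forall>x \<in> carrier R. x \<otimes>\<^bsub>R\<^esub> a = \<zero>\<^bsub>R\<^esub> \<longrightarrow> x = \<zero>\<^bsub>R\<^esub>)"

text \<open>The ring part of \<open>specialization K R \<epsilon>\<close> is \<open>R Quot PIdl\<^bsub>R\<^esub> (q - \<epsilon>)\<close>;
  here \<open>PIdl\<close> is two-sided because \<open>q - \<epsilon>\<close> is central.\<close>

definition specialization ::
  "('k, 'l) ring_scheme \<Rightarrow> (int \<Rightarrow> 'k, 'r, 'm) module_scheme \<Rightarrow> 'k \<Rightarrow> ('k, 'r set) module" where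
  "specialization K R \<epsilon> =
     (let I = PIdl\<^bsub>R\<^esub> (q_minus K R \<epsilon>) in
      ring.extend (R Quot I)
        (module.fields (\<lambda>c X. \<Union>x \<in> X. I +>\<^bsub>R\<^esub> (laurent_const K c \<odot>\<^bsub>R\<^esub> x))))"

definition spec_proj ::
  "('k, 'l) ring_scheme \<Rightarrow> (int \<Rightarrow> 'k, 'r, 'm) module_scheme \<Rightarrow> 'k \<Rightarrow> 'r \<Rightarrow> 'r set" where
  "spec_proj K R \<epsilon> x = PIdl\<^bsub>R\<^esub> (q_minus K R \<epsilon>) +>\<^bsub>R\<^esub> x"

text \<open>In the bracket, \<open>y\<close> is the quotient of \<open>x\<^sub>1 x\<^sub>2 - x\<^sub>2 x\<^sub>1\<close> by \<open>q - \<epsilon>\<close>. The bracket is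
  meaningful on the center of the specialization only, see \<open>spec_bracket_eq\<close> below.\<close>

definition spec_bracket ::
  "('k, 'l) ring_scheme \<Rightarrow> (int \<Rightarrow> 'k, 'r, 'm) module_scheme \<Rightarrow> 'k \<Rightarrow>
     'r set \<Rightarrow> 'r set \<Rightarrow> 'r set" where
  "spec_bracket K R \<epsilon> z1 z2 =
     (THE w. \<exists>x1 \<in> carrier R. \<exists>x2 \<in> carrier R. \<exists>y \<in> carrier R.
        spec_proj K R \<epsilon> x1 = z1 \<and> spec_proj K R \<epsilon> x2 = z2 \<and>
        q_minus K R \<epsilon> \<otimes>\<^bsub>R\<^esub> y = (x1 \<otimes>\<^bsub>R\<^esub> x2) \<ominus>\<^bsub>R\<^esub> (x2 \<otimes>\<^bsub>R\<^esub> x1) \<and>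
        w = spec_proj K R \<epsilon> y)"

lemma (in abelian_group) minus_rearrange:
  assumes "a \<in> carrier G" "b \<in> carrier G" "c \<in> carrier G" "d \<in> carrier G"
    "e \<in> carrier G" "f \<in> carrier G"
  shows "(a \<ominus> b) \<ominus> (e \<ominus> f) = ((a \<ominus> c) \<ominus> (b \<ominus> d)) \<oplus> ((c \<ominus> e) \<ominus> (d \<ominus> f))"
proof -
  have "((a \<ominus> c) \<ominus> (b \<ominus> d)) \<oplus> ((c \<ominus> e) \<ominus> (d \<ominus> f))
     = ((a \<ominus> b) \<ominus> (e \<ominus> f)) \<oplus> ((c \<oplus> \<ominus> c) \<oplus> (d \<oplus> \<ominus> d))"
    using assms by (simp add: minus_eq minus_add a_ac del: r_neg)
  then show ?thesis using assms by (simp add: r_neg)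
qed
lemma (in ring) commutator_diff:
  assumes "a \<in> carrier R" "b \<in> carrier R" "c \<in> carrier R" "d \<in> carrier R"
  shows "(a \<otimes> b \<ominus> b \<otimes> a) \<ominus> (c \<otimes> d \<ominus> d \<otimes> c) =
    ((a \<ominus> c) \<otimes> b \<ominus> b \<otimes> (a \<ominus> c)) \<oplus> (c \<otimes> (b \<ominus> d) \<ominus> (b \<ominus> d) \<otimes> c)"
  using assms minus_rearrange[of "a \<otimes> b" "b \<otimes> a" "c \<otimes> b" "b \<otimes> c" "c \<otimes> d" "d \<otimes> c"]
  by (simp add: minus_eq l_distr r_distr l_minus r_minus)
lemma specialization_simps:
  fixes K (structure) and R \<epsilon>
  defines "I \<equiv> PIdl\<^bsub>R\<^esub> (q_minus K R \<epsilon>)"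
  shows "carrier (specialization K R \<epsilon>) = carrier (R Quot I)"
    "monoid.mult (specialization K R \<epsilon>) = monoid.mult (R Quot I)"
    "one (specialization K R \<epsilon>) = one (R Quot I)"
    "ring.zero (specialization K R \<epsilon>) = ring.zero (R Quot I)"
    "add (specialization K R \<epsilon>) = add (R Quot I)"
    "smult (specialization K R \<epsilon>) = (\<lambda>c X. \<Union>x \<in> X. I +>\<^bsub>R\<^esub> (laurent_const K c \<odot>\<^bsub>R\<^esub> x))"
  by (simp_all add: specialization_def I_def Let_def ring.defs module.defs)

locale laurent_algebra = K: cring K + assoc_algebra "laurent K" R
  for K (structure) and R (structure)
begin

context fixes \<epsilon> assumes eps: "\<epsilon> \<in> carrier K"
begin

interpretation L: cring "laurent K" by (rule K.laurent_cring)

lemma q_minus_closed: "q_minus K R \<epsilon> \<in> carrier R"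
  unfolding q_minus_def
  using eps by (simp add: K.laurent_var_closed K.laurent_const_closed a_minus_def)

lemma q_minus_central:
  assumes "x \<in> carrier R"
  shows "q_minus K R \<epsilon> \<otimes>\<^bsub>R\<^esub> x = x \<otimes>\<^bsub>R\<^esub> q_minus K R \<epsilon>"
  using assms eps unfolding q_minus_def
  by (simp add: smult_mult_left smult_mult_right K.laurent_var_closed K.laurent_const_closed)

lemma spec_ideal: "ideal (PIdl\<^bsub>R\<^esub> (q_minus K R \<epsilon>)) R"
proof (rule idealI)
  let ?a = "q_minus K R \<epsilon>"
  note [simp] = q_minus_closed
  show "subgroup (PIdl\<^bsub>R\<^esub> ?a) (add_monoid R)"
  proof (rule M.add.subgroupI)
    show "PIdl\<^bsub>R\<^esub> ?a \<noteq> {}"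
      unfolding cgenideal_def using M.one_closed by blast
  next
    fix x assume "x \<in> PIdl\<^bsub>R\<^esub> ?a"
    then obtain u where "u \<in> carrier R" "x = u \<otimes>\<^bsub>R\<^esub> ?a" by (auto simp: cgenideal_def)
    then show "\<ominus>\<^bsub>R\<^esub> x \<in> PIdl\<^bsub>R\<^esub> ?a"
      unfolding cgenideal_def by (auto simp: M.l_minus[symmetric] intro!: exI[of _ "\<ominus>\<^bsub>R\<^esub> u"])
  next
    fix x y assume "x \<in> PIdl\<^bsub>R\<^esub> ?a" "y \<in> PIdl\<^bsub>R\<^esub> ?a"
    then obtain u v where "u \<in> carrier R" "x = u \<otimes>\<^bsub>R\<^esub> ?a" "v \<in> carrier R" "y = v \<otimes>\<^bsub>R\<^esub> ?a"
      by (auto simp: cgenideal_def)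
    then show "x \<oplus>\<^bsub>R\<^esub> y \<in> PIdl\<^bsub>R\<^esub> ?a"
      unfolding cgenideal_def by (auto simp: M.l_distr intro!: exI[of _ "u \<oplus>\<^bsub>R\<^esub> v"])
  qed (auto simp: cgenideal_def)
next
  let ?a = "q_minus K R \<epsilon>"
  note [simp] = q_minus_closed
  fix x y assume "x \<in> PIdl\<^bsub>R\<^esub> ?a" and y: "y \<in> carrier R"
  then obtain u where u: "u \<in> carrier R" "x = u \<otimes>\<^bsub>R\<^esub> ?a" by (auto simp: cgenideal_def)
  then show "y \<otimes>\<^bsub>R\<^esub> x \<in> PIdl\<^bsub>R\<^esub> ?a"
    using y unfolding cgenideal_def
    by (auto simp: M.m_assoc intro!: exI[of _ "y \<otimes>\<^bsub>R\<^esub> u"])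
  have "x \<otimes>\<^bsub>R\<^esub> y = (u \<otimes>\<^bsub>R\<^esub> y) \<otimes>\<^bsub>R\<^esub> ?a"
    using u y by (simp add: M.m_assoc q_minus_central)
  then show "x \<otimes>\<^bsub>R\<^esub> y \<in> PIdl\<^bsub>R\<^esub> ?a"
    using u y unfolding cgenideal_def by blast
qed (rule M.ring_axioms)

interpretation I: ideal "PIdl\<^bsub>R\<^esub> (q_minus K R \<epsilon>)" R by (rule spec_ideal)

lemma spec_proj_hom: "spec_proj K R \<epsilon> \<in> ring_hom R (specialization K R \<epsilon>)"
proof -
  have "spec_proj K R \<epsilon> = (+>\<^bsub>R\<^esub>) (PIdl\<^bsub>R\<^esub> (q_minus K R \<epsilon>))"
    by (rule ext) (simp add: spec_proj_def)
  then show ?thesis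
    using I.rcos_ring_hom by (simp add: ring_hom_def specialization_simps)
qed

lemma spec_carrier: "carrier (specialization K R \<epsilon>) = spec_proj K R \<epsilon> ` carrier R"
  by (auto simp: specialization_simps FactRing_def A_RCOSETS_def' spec_proj_def)

lemma spec_proj_eq_iff:
  assumes "x \<in> carrier R" "y \<in> carrier R"
  shows "spec_proj K R \<epsilon> x = spec_proj K R \<epsilon> y \<longleftrightarrow>
    (\<exists>u \<in> carrier R. x \<ominus>\<^bsub>R\<^esub> y = q_minus K R \<epsilon> \<otimes>\<^bsub>R\<^esub> u)"
proof -
  have proj: "spec_proj K R \<epsilon> x = spec_proj K R \<epsilon> y \<longleftrightarrow>
      x \<ominus>\<^bsub>R\<^esub> y \<in> PIdl\<^bsub>R\<^esub> (q_minus K R \<epsilon>)"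
    unfolding spec_proj_def by (rule M.quotient_eq_iff_same_a_r_cos[OF spec_ideal assms, symmetric])
  have PIdl: "PIdl\<^bsub>R\<^esub> (q_minus K R \<epsilon>) = {q_minus K R \<epsilon> \<otimes>\<^bsub>R\<^esub> u | u. u \<in> carrier R}"
    unfolding cgenideal_def by (rule Collect_cong) (metis q_minus_central)
  show ?thesis
    unfolding proj PIdl by blast
qed

lemma spec_smult:
  assumes c: "c \<in> carrier K" and x: "x \<in> carrier R"
  shows "c \<odot>\<^bsub>specialization K R \<epsilon>\<^esub> spec_proj K R \<epsilon> x =
    spec_proj K R \<epsilon> (laurent_const K c \<odot>\<^bsub>R\<^esub> x)"
proof -
  let ?c = "laurent_const K c"
  note cc = K.laurent_const_closed[OF c]
  have "spec_proj K R \<epsilon> (?c \<odot>\<^bsub>R\<^esub> y) = spec_proj K R \<epsilon> (?c \<odot>\<^bsub>R\<^esub> x)"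
    if y: "y \<in> spec_proj K R \<epsilon> x" for y
  proof -
    obtain u where u: "u \<in> carrier R" "y = u \<otimes>\<^bsub>R\<^esub> q_minus K R \<epsilon> \<oplus>\<^bsub>R\<^esub> x"
      using y unfolding spec_proj_def a_r_coset_def' cgenideal_def by blast
    have "?c \<odot>\<^bsub>R\<^esub> y = (?c \<odot>\<^bsub>R\<^esub> u) \<otimes>\<^bsub>R\<^esub> q_minus K R \<epsilon> \<oplus>\<^bsub>R\<^esub> ?c \<odot>\<^bsub>R\<^esub> x"
      using u x cc q_minus_closed by (simp add: smult_r_distr smult_mult_left)
    then have "?c \<odot>\<^bsub>R\<^esub> y \<ominus>\<^bsub>R\<^esub> ?c \<odot>\<^bsub>R\<^esub> x = q_minus K R \<epsilon> \<otimes>\<^bsub>R\<^esub> (?c \<odot>\<^bsub>R\<^esub> u)"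
      using u x cc q_minus_closed
      by (simp add: q_minus_central M.minus_eq M.a_assoc M.r_neg)
    then show ?thesis
      using u x cc q_minus_closed by (subst spec_proj_eq_iff) auto
  qed
  moreover have "x \<in> spec_proj K R \<epsilon> x"
    unfolding spec_proj_def using x by (rule I.a_rcos_self)
  ultimately show ?thesis
    unfolding specialization_simps spec_proj_def[symmetric] by blast
qed

lemma spec_algebra: "assoc_algebra K (specialization K R \<epsilon>)"
proof -
  let ?S = "specialization K R \<epsilon>" and ?p = "spec_proj K R \<epsilon>"
  note cc = K.laurent_const_closed
  have ring: "ring ?S"
  proof -
    let ?Q = "R Quot PIdl\<^bsub>R\<^esub> (q_minus K R \<epsilon>)"
    interpret Q: ring ?Q by (rule I.quotient_is_ring)
    have "\<exists>y \<in> carrier ?Q. y \<oplus>\<^bsub>?Q\<^esub> x = \<zero>\<^bsub>?Q\<^esub>" if "x \<in> carrier ?Q" for x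
      using that by (intro bexI[of _ "\<ominus>\<^bsub>?Q\<^esub> x"]) (simp_all add: Q.l_neg)
    then have "abelian_group ?S"
      by (intro abelian_groupI) (simp_all add: specialization_simps Q.a_ac)
    moreover have "Group.monoid ?S"
      by (rule Group.monoidI) (auto simp: specialization_simps Q.m_assoc)
    ultimately show ?thesis
      by (rule ringI) (auto simp: specialization_simps Q.l_distr Q.r_distr)
  qed
  interpret S: ring ?S by (rule ring)
  have add: "?p x \<oplus>\<^bsub>?S\<^esub> ?p y = ?p (x \<oplus>\<^bsub>R\<^esub> y)"
    and mult: "?p x \<otimes>\<^bsub>?S\<^esub> ?p y = ?p (x \<otimes>\<^bsub>R\<^esub> y)"
    if "x \<in> carrier R" "y \<in> carrier R" for x y
    using spec_proj_hom that by (auto simp: ring_hom_def)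
  have const_add: "laurent_const K (c \<oplus> d) = laurent_const K c \<oplus>\<^bsub>laurent K\<^esub> laurent_const K d"
    if "c \<in> carrier K" "d \<in> carrier K" for c d
    using that by (auto simp: laurent_const_def laurent_simps)
  have const_mult: "laurent_const K (c \<otimes> d) = laurent_const K c \<otimes>\<^bsub>laurent K\<^esub> laurent_const K d"
    if "c \<in> carrier K" "d \<in> carrier K" for c d
    using that by (auto simp: K.laurent_const_mult cc) (auto simp: laurent_const_def)
  show ?thesis
    by (intro assoc_algebra.intro assoc_algebra_axioms.intro moduleI ring K.cring_axioms
        S.abelian_group_axioms)
      (auto simp: spec_carrier spec_smult add mult cc const_add const_mult smult_l_distr
        smult_r_distr smult_assoc1 K.laurent_const_one smult_mult_left smult_mult_right)
qed

lemma spec_bracket_eq: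
  assumes reg: "regular_element R (q_minus K R \<epsilon>)"
    and x: "x1 \<in> carrier R" "x2 \<in> carrier R"
    and center: "spec_proj K R \<epsilon> x1 \<in> ring_center (specialization K R \<epsilon>)"
      "spec_proj K R \<epsilon> x2 \<in> ring_center (specialization K R \<epsilon>)"
  shows "\<exists>!y. y \<in> carrier R \<and> q_minus K R \<epsilon> \<otimes>\<^bsub>R\<^esub> y = x1 \<otimes>\<^bsub>R\<^esub> x2 \<ominus>\<^bsub>R\<^esub> x2 \<otimes>\<^bsub>R\<^esub> x1"
    and "y \<in> carrier R \<Longrightarrow> q_minus K R \<epsilon> \<otimes>\<^bsub>R\<^esub> y = x1 \<otimes>\<^bsub>R\<^esub> x2 \<ominus>\<^bsub>R\<^esub> x2 \<otimes>\<^bsub>R\<^esub> x1 \<Longrightarrow>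
      spec_bracket K R \<epsilon> (spec_proj K R \<epsilon> x1) (spec_proj K R \<epsilon> x2) = spec_proj K R \<epsilon> y"
proof -
  let ?a = "q_minus K R \<epsilon>" and ?p = "spec_proj K R \<epsilon>" and ?S = "specialization K R \<epsilon>"
  note [simp] = q_minus_closed
  have mult: "?p x \<otimes>\<^bsub>?S\<^esub> ?p y = ?p (x \<otimes>\<^bsub>R\<^esub> y)"
    if "x \<in> carrier R" "y \<in> carrier R" for x y
    using spec_proj_hom that by (auto simp: ring_hom_def)
  have comm: "\<exists>u \<in> carrier R. x \<otimes>\<^bsub>R\<^esub> y \<ominus>\<^bsub>R\<^esub> y \<otimes>\<^bsub>R\<^esub> x = ?a \<otimes>\<^bsub>R\<^esub> u"
    if "?p x \<in> ring_center ?S" "x \<in> carrier R" "y \<in> carrier R" for x y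
  proof -
    have "?p x \<otimes>\<^bsub>?S\<^esub> ?p y = ?p y \<otimes>\<^bsub>?S\<^esub> ?p x"
      using that by (simp add: ring_center_def spec_carrier)
    then show ?thesis using that by (simp add: mult spec_proj_eq_iff)
  qed
  have cancel: "y = z"
    if "y \<in> carrier R" "z \<in> carrier R" "?a \<otimes>\<^bsub>R\<^esub> y = ?a \<otimes>\<^bsub>R\<^esub> z" for y z
  proof -
    have "?a \<otimes>\<^bsub>R\<^esub> (y \<ominus>\<^bsub>R\<^esub> z) = \<zero>\<^bsub>R\<^esub>"
      using that by (simp add: M.minus_eq M.r_distr M.r_minus M.r_neg)
    then have "y \<ominus>\<^bsub>R\<^esub> z = \<zero>\<^bsub>R\<^esub>"
      using reg M.minus_closed[OF that(1,2)] unfolding regular_element_def by blast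
    then have "y \<oplus>\<^bsub>R\<^esub> \<ominus>\<^bsub>R\<^esub> z = \<zero>\<^bsub>R\<^esub>" by (simp add: M.minus_eq)
    then show ?thesis
      using M.minus_equality[of y "\<ominus>\<^bsub>R\<^esub> z"] that(1,2) by simp
  qed
  show "\<exists>!y. y \<in> carrier R \<and> ?a \<otimes>\<^bsub>R\<^esub> y = x1 \<otimes>\<^bsub>R\<^esub> x2 \<ominus>\<^bsub>R\<^esub> x2 \<otimes>\<^bsub>R\<^esub> x1"
    using comm[OF center(1) x] cancel by metis
  assume y: "y \<in> carrier R" "?a \<otimes>\<^bsub>R\<^esub> y = x1 \<otimes>\<^bsub>R\<^esub> x2 \<ominus>\<^bsub>R\<^esub> x2 \<otimes>\<^bsub>R\<^esub> x1"
  have unique: "?p y' = ?p y"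
    if x': "x1' \<in> carrier R" "x2' \<in> carrier R" "y' \<in> carrier R" "?p x1' = ?p x1" "?p x2' = ?p x2"
      "?a \<otimes>\<^bsub>R\<^esub> y' = x1' \<otimes>\<^bsub>R\<^esub> x2' \<ominus>\<^bsub>R\<^esub> x2' \<otimes>\<^bsub>R\<^esub> x1'" for x1' x2' y'
  proof -
    obtain u where u: "u \<in> carrier R" "x1' \<ominus>\<^bsub>R\<^esub> x1 = ?a \<otimes>\<^bsub>R\<^esub> u"
      using spec_proj_eq_iff[OF x'(1) x(1)] x'(4) by blast
    obtain v where v: "v \<in> carrier R" "x2' \<ominus>\<^bsub>R\<^esub> x2 = ?a \<otimes>\<^bsub>R\<^esub> v"
      using spec_proj_eq_iff[OF x'(2) x(2)] x'(5) by blast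
    have "?p x2' \<in> ring_center ?S" using center(2) x'(5) by simp
    then obtain s where s: "s \<in> carrier R" "x2' \<otimes>\<^bsub>R\<^esub> u \<ominus>\<^bsub>R\<^esub> u \<otimes>\<^bsub>R\<^esub> x2' = ?a \<otimes>\<^bsub>R\<^esub> s"
      using comm x'(2) u(1) by blast
    obtain t where t: "t \<in> carrier R" "x1 \<otimes>\<^bsub>R\<^esub> v \<ominus>\<^bsub>R\<^esub> v \<otimes>\<^bsub>R\<^esub> x1 = ?a \<otimes>\<^bsub>R\<^esub> t"
      using comm[OF center(1) x(1) v(1)] by blast
    have "?a \<otimes>\<^bsub>R\<^esub> (y' \<ominus>\<^bsub>R\<^esub> y)
        = (x1' \<otimes>\<^bsub>R\<^esub> x2' \<ominus>\<^bsub>R\<^esub> x2' \<otimes>\<^bsub>R\<^esub> x1') \<ominus>\<^bsub>R\<^esub> (x1 \<otimes>\<^bsub>R\<^esub> x2 \<ominus>\<^bsub>R\<^esub> x2 \<otimes>\<^bsub>R\<^esub> x1)"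
      unfolding y(2)[symmetric] x'(6)[symmetric]
      using y(1) x'(3) by (simp add: M.minus_eq M.r_distr M.r_minus)
    also have "\<dots> = ((x1' \<ominus>\<^bsub>R\<^esub> x1) \<otimes>\<^bsub>R\<^esub> x2' \<ominus>\<^bsub>R\<^esub> x2' \<otimes>\<^bsub>R\<^esub> (x1' \<ominus>\<^bsub>R\<^esub> x1))
        \<oplus>\<^bsub>R\<^esub> (x1 \<otimes>\<^bsub>R\<^esub> (x2' \<ominus>\<^bsub>R\<^esub> x2) \<ominus>\<^bsub>R\<^esub> (x2' \<ominus>\<^bsub>R\<^esub> x2) \<otimes>\<^bsub>R\<^esub> x1)"
      by (rule M.commutator_diff[OF x'(1,2) x])
    also have "\<dots> = ?a \<otimes>\<^bsub>R\<^esub> ((u \<otimes>\<^bsub>R\<^esub> x2' \<ominus>\<^bsub>R\<^esub> x2' \<otimes>\<^bsub>R\<^esub> u) \<oplus>\<^bsub>R\<^esub> (x1 \<otimes>\<^bsub>R\<^esub> v \<ominus>\<^bsub>R\<^esub> v \<otimes>\<^bsub>R\<^esub> x1))"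
    proof -
      have "x2' \<otimes>\<^bsub>R\<^esub> (?a \<otimes>\<^bsub>R\<^esub> u) = ?a \<otimes>\<^bsub>R\<^esub> (x2' \<otimes>\<^bsub>R\<^esub> u)"
        using u(1) x'(2) q_minus_closed q_minus_central by (metis M.m_assoc)
      moreover have "x1 \<otimes>\<^bsub>R\<^esub> (?a \<otimes>\<^bsub>R\<^esub> v) = ?a \<otimes>\<^bsub>R\<^esub> (x1 \<otimes>\<^bsub>R\<^esub> v)"
        using v(1) x(1) q_minus_closed q_minus_central by (metis M.m_assoc)
      ultimately show ?thesis
        unfolding u(2) v(2) using u(1) v(1) x(1) x'(2)
        by (simp add: M.m_assoc M.r_distr M.minus_eq M.r_minus)
    qed
    finally have "y' \<ominus>\<^bsub>R\<^esub> y
        = (u \<otimes>\<^bsub>R\<^esub> x2' \<ominus>\<^bsub>R\<^esub> x2' \<otimes>\<^bsub>R\<^esub> u) \<oplus>\<^bsub>R\<^esub> (x1 \<otimes>\<^bsub>R\<^esub> v \<ominus>\<^bsub>R\<^esub> v \<otimes>\<^bsub>R\<^esub> x1)"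
      by (rule cancel[rotated 2]) (use u(1) v(1) x(1) x'(2,3) y(1) in simp_all)
    also have "u \<otimes>\<^bsub>R\<^esub> x2' \<ominus>\<^bsub>R\<^esub> x2' \<otimes>\<^bsub>R\<^esub> u = \<ominus>\<^bsub>R\<^esub> (x2' \<otimes>\<^bsub>R\<^esub> u \<ominus>\<^bsub>R\<^esub> u \<otimes>\<^bsub>R\<^esub> x2')"
      using u(1) x'(2) by (simp add: M.minus_eq M.minus_add M.a_comm)
    finally have "y' \<ominus>\<^bsub>R\<^esub> y = ?a \<otimes>\<^bsub>R\<^esub> (\<ominus>\<^bsub>R\<^esub> s \<oplus>\<^bsub>R\<^esub> t)"
      unfolding s(2) t(2) using s(1) t(1) by (simp add: M.r_distr M.r_minus)
    then show ?thesis
      unfolding spec_proj_eq_iff[OF x'(3) y(1)] using s(1) t(1)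
      by (intro bexI[of _ "\<ominus>\<^bsub>R\<^esub> s \<oplus>\<^bsub>R\<^esub> t"]) simp_all
  qed
  show "spec_bracket K R \<epsilon> (?p x1) (?p x2) = ?p y"
    unfolding spec_bracket_def
  proof (rule the_equality)
    show "\<exists>x1'\<in>carrier R. \<exists>x2'\<in>carrier R. \<exists>y'\<in>carrier R. ?p x1' = ?p x1 \<and> ?p x2' = ?p x2 \<and>
        ?a \<otimes>\<^bsub>R\<^esub> y' = (x1' \<otimes>\<^bsub>R\<^esub> x2') \<ominus>\<^bsub>R\<^esub> (x2' \<otimes>\<^bsub>R\<^esub> x1') \<and> ?p y = ?p y'"
      using x y by blast
  qed (use unique in blast)
qed

end

end

definition poisson_subalgebra ::
  "('k, 'l) ring_scheme \<Rightarrow> ('k, 'a, 'm) module_scheme \<Rightarrow> ('a \<Rightarrow> 'a \<Rightarrow> 'a) \<Rightarrow> 'a set \<Rightarrow> bool" where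
  "poisson_subalgebra K A br C \<longleftrightarrow>
     unital_subalgebra K A C \<and> (\<forall>x \<in> C. \<forall>y \<in> C. br x y \<in> C)"

definition poisson_ideal ::
  "('a, 'm) ring_scheme \<Rightarrow> ('a \<Rightarrow> 'a \<Rightarrow> 'a) \<Rightarrow> 'a set \<Rightarrow> bool" where
  "poisson_ideal C br I \<longleftrightarrow>
     ideal I C \<and> (\<forall>x \<in> I. \<forall>c \<in> carrier C. br x c \<in> I)"

end

theory Submission
  imports Defs
begin

text \<open>A derivation acts on \<open>det [tr (x\<^sub>i y\<^sub>j)]\<close> by the Leibniz rule. Since it commutes
  with the trace, each entry becomes \<open>tr (\<partial>x\<^sub>i y\<^sub>j) + tr (x\<^sub>i \<partial>y\<^sub>j)\<close>. Grouping the first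
  summands by rows and the second ones by columns gives the sum over \<open>k\<close> of the determinants
  in which \<open>x\<^sub>k\<close>, respectively \<open>y\<^sub>k\<close>, is replaced by its derivative; these are again
  generators of the discriminant ideal. For the Poisson statement, bracketing with \<open>\<sigma>(c)\<close>
  extends from the center to the derivation \<open>\<sigma>(x) \<mapsto> \<sigma>((x c - c x) / (q - \<epsilon>))\<close> of the whole
  specialization, to which the first part applies.\<close>

section \<open>Leibniz terms and determinants over a commutative ring\<close>

definition leibniz_term ::
  "('a, 'm) ring_scheme \<Rightarrow> 'i set \<Rightarrow> ('i \<Rightarrow> 'i \<Rightarrow> 'a) \<Rightarrow> ('i \<Rightarrow> 'i) \<Rightarrow> 'a" where
  "leibniz_term C N M p =
     (if evenperm p then (\<Otimes>\<^bsub>C\<^esub>i \<in> N. M i (p i))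
      else \<ominus>\<^bsub>C\<^esub> (\<Otimes>\<^bsub>C\<^esub>i \<in> N. M i (p i)))"

lemma ring_det_leibniz:
  "ring_det C n M = (\<Oplus>\<^bsub>C\<^esub>p \<in> {p. p permutes {1..n}}. leibniz_term C {1..n} M p)"
  unfolding ring_det_def leibniz_term_def ..

lemma (in abelian_group) finsum_minus:
  assumes "finite A" "f \<in> A \<rightarrow> carrier G"
  shows "\<ominus> (\<Oplus>i\<in>A. f i) = (\<Oplus>i\<in>A. \<ominus> f i)"
  using assms
proof (induction A)
  case empty
  then show ?case by simp
next
  case (insert x A)
  then show ?case by (simp add: minus_add Pi_def)
qed

context cring
begin

lemma finprod_split_entry:
  assumes "finite A" "k \<in> A" "f \<in> A \<rightarrow> carrier R" "u \<in> carrier R"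
  shows "(\<Otimes>i\<in>A. if i = k then u else f i) = u \<otimes> (\<Otimes>i\<in>A - {k}. f i)"
proof -
  have A: "A = insert k (A - {k})" using assms(2) by blast
  have "(\<Otimes>i\<in>insert k (A - {k}). if i = k then u else f i)
      = u \<otimes> (\<Otimes>i\<in>A - {k}. if i = k then u else f i)"
    using assms by (subst finprod_insert) (auto simp: Pi_iff)
  also have "(\<Otimes>i\<in>A - {k}. if i = k then u else f i) = (\<Otimes>i\<in>A - {k}. f i)"
    using assms by (intro finprod_cong') (auto simp: Pi_iff)
  finally show ?thesis using A by simp
qed

text \<open>Pulling out the factor at \<open>k\<close> with \<open>finprod_split_entry\<close>
  reduces this to distributivity. It later separates the two summands of a differentiated matrix
  entry.\<close>

lemma finprod_entry_add:
  assumes "finite A" "k \<in> A" "f \<in> A \<rightarrow> carrier R" "u \<in> carrier R" "v \<in> carrier R"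
  shows "(\<Otimes>i\<in>A. if i = k then u \<oplus> v else f i)
    = (\<Otimes>i\<in>A. if i = k then u else f i) \<oplus> (\<Otimes>i\<in>A. if i = k then v else f i)"
proof -
  have "(\<Otimes>i\<in>A - {k}. f i) \<in> carrier R" using assms by (intro finprod_closed) auto
  then show ?thesis using assms by (simp add: finprod_split_entry l_distr)
qed

lemma leibniz_term_closed:
  assumes "p permutes N" "\<And>i j. i \<in> N \<Longrightarrow> j \<in> N \<Longrightarrow> M i j \<in> carrier R"
  shows "leibniz_term R N M p \<in> carrier R"
proof -
  have "(\<lambda>i. M i (p i)) \<in> N \<rightarrow> carrier R"
    using assms permutes_in_image[OF assms(1)] by blast
  then show ?thesis by (simp add: leibniz_term_def)
qed

lemma ring_det_closed:
  assumes "\<And>i j. i \<in> {1..n} \<Longrightarrow> j \<in> {1..n} \<Longrightarrow> M i j \<in> carrier R"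
  shows "ring_det R n M \<in> carrier R"
  unfolding ring_det_leibniz by (intro finsum_closed) (auto intro!: leibniz_term_closed assms)

lemma ideal_finsum_closed:
  assumes "ideal I R" "finite A" "\<And>i. i \<in> A \<Longrightarrow> f i \<in> I"
  shows "(\<Oplus>i\<in>A. f i) \<in> I"
proof -
  interpret I: ideal I R by (rule assms(1))
  show ?thesis using assms(2,3)
  proof (induction A)
    case empty
    then show ?case by (simp add: I.zero_closed)
  next
    case (insert x A)
    then show ?case by (subst finsum_insert) auto
  qed
qed

end

section \<open>Derivations of a commutative ring: products, determinants and generated
  ideals\<close>

locale cring_derivation = cring +
  fixes d
  assumes d_closed: "x \<in> carrier R \<Longrightarrow> d x \<in> carrier R"
    and d_add: "\<lbrakk>x \<in> carrier R; y \<in> carrier R\<rbrakk> \<Longrightarrow> d (x \<oplus> y) = d x \<oplus> d y"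
    and d_mult: "\<lbrakk>x \<in> carrier R; y \<in> carrier R\<rbrakk> \<Longrightarrow> d (x \<otimes> y) = d x \<otimes> y \<oplus> x \<otimes> d y"
begin

lemma d_zero: "d \<zero> = \<zero>"
  using d_add[of \<zero> \<zero>] d_closed[of \<zero>] add.l_cancel_one by fastforce

lemma d_one: "d \<one> = \<zero>"
  using d_mult[of \<one> \<one>] d_closed[of \<one>] add.l_cancel_one by fastforce

lemma d_minus:
  assumes "x \<in> carrier R"
  shows "d (\<ominus> x) = \<ominus> d x"
proof -
  have "d (\<ominus> x) \<oplus> d x = \<zero>"
    using assms d_add[of "\<ominus> x" x] by (simp add: l_neg d_zero)
  then show ?thesis using assms by (intro minus_equality[symmetric]) (auto simp: Pi_iff intro: d_closed)
qed

lemma d_finsum: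
  assumes "finite A" "f \<in> A \<rightarrow> carrier R"
  shows "d (\<Oplus>i\<in>A. f i) = (\<Oplus>i\<in>A. d (f i))"
  using assms
proof (induction A)
  case empty
  then show ?case by (simp add: d_zero)
next
  case (insert x A)
  then show ?case by (simp add: d_add d_closed finsum_insert Pi_def)
qed

text \<open>The product rule for many factors. Each summand stays a product over all of
  \<open>A\<close>, with one factor replaced, so that it can be read as the product of a matrix with
  one changed row or column.\<close>

lemma d_finprod:
  assumes "finite A" "f \<in> A \<rightarrow> carrier R"
  shows "d (\<Otimes>i\<in>A. f i) = (\<Oplus>k\<in>A. \<Otimes>i\<in>A. if i = k then d (f k) else f i)"
  using assms
proof (induction A)
  case empty
  then show ?case by (simp add: d_one)
next
  case (insert x A)
  have f: "f x \<in> carrier R" "f \<in> A \<rightarrow> carrier R" using insert.prems by auto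
  have prod: "(\<Otimes>i\<in>A. if i = k then d (f k) else f i) \<in> carrier R" if "k \<in> A" for k
    using f that by (intro finprod_closed) (auto simp: Pi_iff intro: d_closed)
  have head: "(\<Otimes>i\<in>insert x A. if i = x then d (f x) else f i) = d (f x) \<otimes> (\<Otimes>i\<in>A. f i)"
    using insert.hyps f
    by (subst finprod_split_entry) (auto simp: d_closed Pi_iff)
  \<comment> \<open>Since \<open>x\<close> is not in \<open>A\<close>, the index \<open>k\<close>
    differs from \<open>x\<close>, so the factor at \<open>x\<close> remains
    \<open>f x\<close>.\<close>
  have tail: "(\<Otimes>i\<in>insert x A. if i = k then d (f k) else f i)
      = f x \<otimes> (\<Otimes>i\<in>A. if i = k then d (f k) else f i)" if "k \<in> A" for k
    using insert.hyps f that
    by (subst finprod_insert) (auto simp: Pi_iff intro: d_closed)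
  have closed: "(\<Otimes>i\<in>insert x A. if i = k then d (f k) else f i) \<in> carrier R"
    if "k \<in> insert x A" for k
    using that f by (intro finprod_closed) (auto simp: Pi_iff intro: d_closed)
  have "d (\<Otimes>i\<in>insert x A. f i)
      = d (f x) \<otimes> (\<Otimes>i\<in>A. f i) \<oplus> f x \<otimes> (\<Oplus>k\<in>A. \<Otimes>i\<in>A. if i = k then d (f k) else f i)"
    using insert f by (simp add: d_mult)
  also have "f x \<otimes> (\<Oplus>k\<in>A. \<Otimes>i\<in>A. if i = k then d (f k) else f i)
      = (\<Oplus>k\<in>A. \<Otimes>i\<in>insert x A. if i = k then d (f k) else f i)"
    using insert.hyps f prod closed
    by (subst finsum_rdistr) (auto simp: tail intro!: finsum_cong')
  also have "d (f x) \<otimes> (\<Otimes>i\<in>A. f i) \<oplus> (\<Oplus>k\<in>A. \<Otimes>i\<in>insert x A. if i = k then d (f k) else f i)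
      = (\<Oplus>k\<in>insert x A. \<Otimes>i\<in>insert x A. if i = k then d (f k) else f i)"
    using insert.hyps closed
    by (subst finsum_insert) (auto simp: head[symmetric] simp del: finprod_insert)
  finally show ?case .
qed

text \<open>The product rule hits one entry at a time, the one in row \<open>k\<close> and column
  \<open>p k\<close>. Its summand \<open>A\<close> is booked as a change of row \<open>k\<close>,
  its summand \<open>B\<close> as a change of column \<open>p k\<close>: a Leibniz term meets each
  row and each column exactly once, so both changes touch this entry only.\<close>

lemma d_leibniz_term:
  assumes N: "finite N" and p: "p permutes N"
    and M: "\<And>i j. i \<in> N \<Longrightarrow> j \<in> N \<Longrightarrow> M i j \<in> carrier R"
    and A: "\<And>i j. i \<in> N \<Longrightarrow> j \<in> N \<Longrightarrow> A i j \<in> carrier R"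
    and B: "\<And>i j. i \<in> N \<Longrightarrow> j \<in> N \<Longrightarrow> B i j \<in> carrier R"
    and dM: "\<And>i j. i \<in> N \<Longrightarrow> j \<in> N \<Longrightarrow> d (M i j) = A i j \<oplus> B i j"
  shows "d (leibniz_term R N M p)
    = (\<Oplus>k\<in>N. leibniz_term R N (\<lambda>i j. if i = k then A i j else M i j) p)
      \<oplus> (\<Oplus>l\<in>N. leibniz_term R N (\<lambda>i j. if j = l then B i j else M i j) p)"
    (is "_ = (\<Oplus>k\<in>_. ?a k) \<oplus> (\<Oplus>l\<in>_. ?b l)")
proof -
  have pin: "p i \<in> N" if "i \<in> N" for i using permutes_in_image[OF p] that by blast
  have inj: "inj p" using p by (rule permutes_inj)
  have Mp: "(\<lambda>i. M i (p i)) \<in> N \<rightarrow> carrier R" using M pin by blast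
  let ?P = "\<lambda>k u. \<Otimes>i\<in>N. if i = k then u else M i (p i)"
  have P: "?P k u \<in> carrier R" if "k \<in> N" "u \<in> carrier R" for k u
    using Mp that by (intro finprod_closed) (auto simp: Pi_iff)
  have a: "?a k \<in> carrier R" if "k \<in> N" for k
    by (intro leibniz_term_closed p) (use A M in auto)
  have b: "?b l \<in> carrier R" if "l \<in> N" for l
    by (intro leibniz_term_closed p) (use B M in auto)
  have da: "(\<Otimes>i\<in>N. if i = k then A i (p i) else M i (p i)) = ?P k (A k (p k))"
    if "k \<in> N" for k
    using Mp pin A that by (intro finprod_cong') auto
  \<comment> \<open>By injectivity of \<open>p\<close>, the condition \<open>p i = p k\<close> of
    the changed column singles out the row \<open>i = k\<close>.\<close>
  have db: "(\<Otimes>i\<in>N. if p i = p k then B i (p i) else M i (p i)) = ?P k (B k (p k))"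
    if "k \<in> N" for k
    using Mp pin B that inj by (intro finprod_cong') (auto simp: inj_eq)
  have split: "?P k (d (M k (p k))) = ?P k (A k (p k)) \<oplus> ?P k (B k (p k))" if "k \<in> N" for k
    unfolding dM[OF that pin[OF that]] using that Mp pin N
    by (intro finprod_entry_add A B) auto
  have dP: "d (\<Otimes>i\<in>N. M i (p i)) = (\<Oplus>k\<in>N. ?P k (d (M k (p k))))"
    by (rule d_finprod) (use Mp N in auto)
  have dMc: "?P k (d (M k (p k))) \<in> carrier R" if "k \<in> N" for k
    using that by (intro P) (use M pin in \<open>auto intro: d_closed\<close>)
  have neg: "\<ominus> (\<Oplus>k\<in>N. ?P k (d (M k (p k)))) = (\<Oplus>k\<in>N. \<ominus> ?P k (d (M k (p k))))"
    using dMc N by (intro finsum_minus) auto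
  have "d (leibniz_term R N M p) = (\<Oplus>k\<in>N. ?a k \<oplus> ?b (p k))"
  proof (cases "evenperm p")
    case True
    then have "d (leibniz_term R N M p) = (\<Oplus>k\<in>N. ?P k (d (M k (p k))))"
      unfolding leibniz_term_def dP[symmetric] by simp
    also have "\<dots> = (\<Oplus>k\<in>N. ?a k \<oplus> ?b (p k))"
      using True a b pin P A B by (intro finsum_cong') (auto simp: leibniz_term_def split da db)
    finally show ?thesis .
  next
    \<comment> \<open>For an odd permutation the sign is moved past \<open>d\<close>, then into the
      sum over \<open>k\<close>, and finally onto each of the two products.\<close>
    case False
    have "d (leibniz_term R N M p) = (\<Oplus>k\<in>N. \<ominus> ?P k (d (M k (p k))))"
      unfolding leibniz_term_def neg[symmetric] dP[symmetric]
      using False d_minus[OF finprod_closed[OF Mp]] by simp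
    also have "\<dots> = (\<Oplus>k\<in>N. ?a k \<oplus> ?b (p k))"
      using False a b pin P A B
      by (intro finsum_cong') (auto simp: leibniz_term_def split da db minus_add)
    finally show ?thesis .
  qed
  also have "\<dots> = (\<Oplus>k\<in>N. ?a k) \<oplus> (\<Oplus>k\<in>N. ?b (p k))"
    using a b pin by (intro finsum_addf) auto
  \<comment> \<open>Reindexing along the bijection \<open>p\<close> turns the sum over rows into a
    sum over columns.\<close>
  also have "(\<Oplus>k\<in>N. ?b (p k)) = (\<Oplus>l\<in>p ` N. ?b l)"
    using b inj permutes_image[OF p] by (intro finsum_reindex[symmetric]) (auto intro: inj_on_subset)
  also have "p ` N = N" using p by (rule permutes_image)
  finally show ?thesis .
qed

text \<open>Summing \<open>d_leibniz_term\<close> over all permutations and moving the sum over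
  rows, respectively columns, to the outside leaves determinants of the changed matrices.\<close>

lemma d_ring_det:
  assumes M: "\<And>i j. i \<in> {1..n} \<Longrightarrow> j \<in> {1..n} \<Longrightarrow> M i j \<in> carrier R"
    and A: "\<And>i j. i \<in> {1..n} \<Longrightarrow> j \<in> {1..n} \<Longrightarrow> A i j \<in> carrier R"
    and B: "\<And>i j. i \<in> {1..n} \<Longrightarrow> j \<in> {1..n} \<Longrightarrow> B i j \<in> carrier R"
    and dM: "\<And>i j. i \<in> {1..n} \<Longrightarrow> j \<in> {1..n} \<Longrightarrow> d (M i j) = A i j \<oplus> B i j"
  shows "d (ring_det R n M)
    = (\<Oplus>k\<in>{1..n}. ring_det R n (\<lambda>i j. if i = k then A i j else M i j))
      \<oplus> (\<Oplus>l\<in>{1..n}. ring_det R n (\<lambda>i j. if j = l then B i j else M i j))"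
proof -
  let ?S = "{p. p permutes {1..n}}"
  let ?a = "\<lambda>k. leibniz_term R {1..n} (\<lambda>i j. if i = k then A i j else M i j)"
  let ?b = "\<lambda>l. leibniz_term R {1..n} (\<lambda>i j. if j = l then B i j else M i j)"
  have fin: "finite ?S" by (simp add: finite_permutations)
  have a: "?a k p \<in> carrier R" if "p \<in> ?S" for k p
    by (intro leibniz_term_closed) (use that A M in auto)
  have b: "?b k p \<in> carrier R" if "p \<in> ?S" for k p
    by (intro leibniz_term_closed) (use that B M in auto)
  have "d (ring_det R n M) = (\<Oplus>p\<in>?S. d (leibniz_term R {1..n} M p))"
    unfolding ring_det_leibniz
    by (intro d_finsum fin) (auto intro!: leibniz_term_closed M)
  also have "\<dots> = (\<Oplus>p\<in>?S. (\<Oplus>k\<in>{1..n}. ?a k p) \<oplus> (\<Oplus>l\<in>{1..n}. ?b l p))"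
    proof (rule finsum_cong')
    show "d (leibniz_term R {1..n} M p) = (\<Oplus>k\<in>{1..n}. ?a k p) \<oplus> (\<Oplus>l\<in>{1..n}. ?b l p)"
      if "p \<in> ?S" for p
      using that by (intro d_leibniz_term M A B dM) simp_all
  qed (use a b in auto)
  also have "\<dots> = (\<Oplus>p\<in>?S. \<Oplus>k\<in>{1..n}. ?a k p) \<oplus> (\<Oplus>p\<in>?S. \<Oplus>l\<in>{1..n}. ?b l p)"
    using a b by (intro finsum_addf) auto
  also have "(\<Oplus>p\<in>?S. \<Oplus>k\<in>{1..n}. ?a k p) = (\<Oplus>k\<in>{1..n}. \<Oplus>p\<in>?S. ?a k p)"
    using a fin by (intro finsum_swap) auto
  also have "(\<Oplus>p\<in>?S. \<Oplus>l\<in>{1..n}. ?b l p) = (\<Oplus>l\<in>{1..n}. \<Oplus>p\<in>?S. ?b l p)"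
    using b fin by (intro finsum_swap) auto
  finally show ?thesis unfolding ring_det_leibniz .
qed

text \<open>Allows stability to be tested on generators, by minimality of the generated
  ideal.\<close>

lemma d_genideal:
  assumes G: "G \<subseteq> carrier R" and dG: "d ` G \<subseteq> Idl G"
  shows "d ` (Idl G) \<subseteq> Idl G"
proof -
  interpret I: ideal "Idl G" R by (rule genideal_ideal[OF G])
  \<comment> \<open>The part of the ideal that \<open>d\<close> does not move out of it. By the
    product rule it is an ideal, and it contains \<open>G\<close> by assumption, so it is all of
    \<open>Idl G\<close>.\<close>
  let ?J = "{x \<in> Idl G. d x \<in> Idl G}"
  have "ideal ?J R"
  proof (rule idealI)
    show "subgroup ?J (add_monoid R)"
      by (rule add.subgroupI)
        (use I.Icarr I.zero_closed d_zero in \<open>auto simp: d_minus d_add intro!: exI[of _ \<zero>]\<close>)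
  next
    fix a x assume "a \<in> ?J" "x \<in> carrier R"
    then show "x \<otimes> a \<in> ?J" "a \<otimes> x \<in> ?J"
      by (auto simp: d_mult I.I_l_closed I.I_r_closed d_closed)
  qed (rule ring_axioms)
  moreover have "G \<subseteq> ?J" using genideal_self[OF G] dG by auto
  ultimately show ?thesis using genideal_minimal by blast
qed

end

section \<open>Algebras with a central trace and their discriminant ideals\<close>

locale trace_algebra = assoc_algebra K S for K (structure) and S (structure) +
  fixes C tr
  assumes subalg: "unital_subalgebra K (center_algebra S) C"
    and trace: "algebra_trace S C tr"
begin

text \<open>The subalgebra \<open>C\<close> is given as a subring of the center, so the center has
  to be known as a ring before \<open>C\<close> can be made into one.\<close>

lemma center_subring: "subring (ring_center S) S"
proof (rule M.subringI)
  have comm: "z \<otimes>\<^bsub>S\<^esub> x = x \<otimes>\<^bsub>S\<^esub> z" if "z \<in> ring_center S" "x \<in> carrier S" for z x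
    using that by (simp add: ring_center_def)
  show sub: "ring_center S \<subseteq> carrier S" by (auto simp: ring_center_def)
  show "\<one>\<^bsub>S\<^esub> \<in> ring_center S" by (simp add: ring_center_def)
  show "\<ominus>\<^bsub>S\<^esub> z \<in> ring_center S" if z: "z \<in> ring_center S" for z
  proof -
    have "\<ominus>\<^bsub>S\<^esub> z \<otimes>\<^bsub>S\<^esub> x = x \<otimes>\<^bsub>S\<^esub> \<ominus>\<^bsub>S\<^esub> z" if "x \<in> carrier S" for x
      using comm[OF z that] z sub that by (auto simp: M.l_minus M.r_minus)
    then show ?thesis using z by (simp add: ring_center_def)
  qed
  fix z w assume zw: "z \<in> ring_center S" "w \<in> ring_center S"
  then have car: "z \<in> carrier S" "w \<in> carrier S" using sub by auto
  have "(z \<oplus>\<^bsub>S\<^esub> w) \<otimes>\<^bsub>S\<^esub> x = x \<otimes>\<^bsub>S\<^esub> (z \<oplus>\<^bsub>S\<^esub> w)" if x: "x \<in> carrier S" for x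
    using comm[OF zw(1) x] comm[OF zw(2) x] car x by (simp add: M.l_distr M.r_distr)
  then show "z \<oplus>\<^bsub>S\<^esub> w \<in> ring_center S" using car by (simp add: ring_center_def)
  have "(z \<otimes>\<^bsub>S\<^esub> w) \<otimes>\<^bsub>S\<^esub> x = x \<otimes>\<^bsub>S\<^esub> (z \<otimes>\<^bsub>S\<^esub> w)" if x: "x \<in> carrier S" for x
  proof -
    have "(z \<otimes>\<^bsub>S\<^esub> w) \<otimes>\<^bsub>S\<^esub> x = z \<otimes>\<^bsub>S\<^esub> (x \<otimes>\<^bsub>S\<^esub> w)"
      using comm[OF zw(2) x] car x by (simp add: M.m_assoc)
    also have "\<dots> = (x \<otimes>\<^bsub>S\<^esub> z) \<otimes>\<^bsub>S\<^esub> w"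
      using comm[OF zw(1) x] car x by (simp add: M.m_assoc[symmetric])
    finally show ?thesis using x car by (simp add: M.m_assoc)
  qed
  then show "z \<otimes>\<^bsub>S\<^esub> w \<in> ring_center S" using car by (simp add: ring_center_def)
qed

lemma C_subring: "subring C (S\<lparr>carrier := ring_center S\<rparr>)"
  using subalg by (simp add: unital_subalgebra_def center_algebra_def)

lemma C_subset: "C \<subseteq> ring_center S"
  using subringE(1)[OF C_subring] by simp

text \<open>Commutativity comes from centrality. This makes the results on determinants and
  derivations of commutative rings available for \<open>C\<close>.\<close>

lemma C_cring: "cring (S\<lparr>carrier := C\<rparr>)"
proof -
  interpret Z: ring "S\<lparr>carrier := ring_center S\<rparr>"
    by (rule M.subring_is_ring[OF center_subring])
  interpret C: ring "S\<lparr>carrier := C\<rparr>"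
    using Z.subring_is_ring[OF C_subring] by simp
  have "x \<otimes>\<^bsub>S\<^esub> y = y \<otimes>\<^bsub>S\<^esub> x" if "x \<in> C" "y \<in> C" for x y
    using that C_subset by (auto simp: ring_center_def)
  then show ?thesis by unfold_locales simp
qed

abbreviation (input) "trace_matrix x y \<equiv> \<lambda>i j. tr (x i \<otimes>\<^bsub>S\<^esub> y j)"

abbreviation (input) "disc_gens n \<equiv>
  {ring_det (S\<lparr>carrier := C\<rparr>) n (trace_matrix x y) | x y.
    x \<in> {1..n::nat} \<rightarrow> carrier S \<and> y \<in> {1..n} \<rightarrow> carrier S}"

lemma trace_closed: "x \<in> carrier S \<Longrightarrow> tr x \<in> C"
  using trace by (auto simp: algebra_trace_def)

lemma trace_add:
  "\<lbrakk>x \<in> carrier S; y \<in> carrier S\<rbrakk> \<Longrightarrow> tr (x \<oplus>\<^bsub>S\<^esub> y) = tr x \<oplus>\<^bsub>S\<^esub> tr y"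
  using trace unfolding algebra_trace_def by blast

lemma disc_gens_subset: "disc_gens n \<subseteq> C"
proof -
  interpret C: cring "S\<lparr>carrier := C\<rparr>" by (rule C_cring)
  have "ring_det (S\<lparr>carrier := C\<rparr>) n (trace_matrix x y) \<in> C"
    if "x \<in> {1..n} \<rightarrow> carrier S" "y \<in> {1..n} \<rightarrow> carrier S" for x y
    using C.ring_det_closed[of n "trace_matrix x y"] that by (fastforce intro: trace_closed)
  then show ?thesis by blast
qed

lemma disc_ideal: "ideal (modified_discriminant_ideal S C tr n) (S\<lparr>carrier := C\<rparr>)"
proof -
  interpret C: cring "S\<lparr>carrier := C\<rparr>" by (rule C_cring)
  show ?thesis
    unfolding modified_discriminant_ideal_def
    by (rule C.genideal_ideal) (use disc_gens_subset in simp)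
qed

text \<open>By \<open>d_genideal\<close> only the generating determinants matter, and
  \<open>d_ring_det\<close> expands the derivative of such a determinant into further generators.
  The commutation with the trace is asked of the single derivation \<open>\<delta>\<close>, so the
  lemma serves both halves of the theorem.\<close>

lemma derivation_disc_ideal:
  assumes der: "derivation K S \<delta>" and stable: "\<delta> ` C \<subseteq> C"
    and comm: "trace_commutes_with S tr \<delta>"
  shows "\<delta> ` modified_discriminant_ideal S C tr n \<subseteq> modified_discriminant_ideal S C tr n"
proof -
  let ?C = "S\<lparr>carrier := C\<rparr>"
  interpret C: cring ?C by (rule C_cring)
  have CS: "C \<subseteq> carrier S" using C_subset by (auto simp: ring_center_def)
  have dcl: "\<delta> x \<in> carrier S" if "x \<in> carrier S" for x
    using der that by (auto simp: derivation_def)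
  \<comment> \<open>Stability of \<open>C\<close> is what makes the restriction of
    \<open>\<delta>\<close> to \<open>C\<close> a derivation of that ring.\<close>
  interpret D: cring_derivation ?C \<delta>
    by unfold_locales (use der stable CS in \<open>auto simp: derivation_def subset_iff\<close>)
  let ?I = "Idl\<^bsub>?C\<^esub> disc_gens n"
  have G: "disc_gens n \<subseteq> carrier ?C" using disc_gens_subset by simp
  interpret I: ideal ?I ?C by (rule C.genideal_ideal[OF G])
  have gen: "ring_det ?C n (trace_matrix x y) \<in> ?I"
    if "x \<in> {1..n} \<rightarrow> carrier S" "y \<in> {1..n} \<rightarrow> carrier S" for x y
    using C.genideal_self[OF G] that by blast
  have "\<delta> (ring_det ?C n (trace_matrix x y)) \<in> ?I"
    if x: "x \<in> {1..n} \<rightarrow> carrier S" and y: "y \<in> {1..n} \<rightarrow> carrier S" for x y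
  proof -
    let ?A = "\<lambda>i j. tr (\<delta> (x i) \<otimes>\<^bsub>S\<^esub> y j)" and ?B = "\<lambda>i j. tr (x i \<otimes>\<^bsub>S\<^esub> \<delta> (y j))"
    let ?M = "trace_matrix x y"
    have car: "x i \<in> carrier S" "y i \<in> carrier S" if "i \<in> {1..n}" for i using x y that by auto
    have closed: "?M i j \<in> carrier ?C" "?A i j \<in> carrier ?C" "?B i j \<in> carrier ?C"
      if "i \<in> {1..n}" "j \<in> {1..n}" for i j
      using car that by (simp_all add: trace_closed dcl)
    \<comment> \<open>Commutation with the trace moves \<open>\<delta>\<close> inside, where the
      Leibniz rule of \<open>S\<close> splits the entry.\<close>
    have entry: "\<delta> (?M i j) = ?A i j \<oplus>\<^bsub>?C\<^esub> ?B i j" if "i \<in> {1..n}" "j \<in> {1..n}" for i j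
    proof -
      have xy: "x i \<in> carrier S" "y j \<in> carrier S" using car that by auto
      have "\<delta> (?M i j) = tr (\<delta> (x i \<otimes>\<^bsub>S\<^esub> y j))"
        using comm xy by (simp add: trace_commutes_with_def)
      also have "\<dots> = tr (\<delta> (x i) \<otimes>\<^bsub>S\<^esub> y j \<oplus>\<^bsub>S\<^esub> x i \<otimes>\<^bsub>S\<^esub> \<delta> (y j))"
        using der xy by (simp add: derivation_def)
      also have "\<dots> = ?A i j \<oplus>\<^bsub>?C\<^esub> ?B i j"
        using trace_add xy dcl by simp
      finally show ?thesis .
    qed
    have "ring_det ?C n (\<lambda>i j. if i = k then ?A i j else ?M i j) \<in> ?I" if k: "k \<in> {1..n}" for k
    proof -
      \<comment> \<open>Row \<open>k\<close> of the trace matrix is the only one that involves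
        \<open>x k\<close>, so changing this row amounts to replacing \<open>x k\<close> by its
        derivative.\<close>
      have "(\<lambda>i j. if i = k then ?A i j else ?M i j) = trace_matrix (x(k := \<delta> (x k))) y"
        by (intro ext) simp
      moreover have "x(k := \<delta> (x k)) \<in> {1..n} \<rightarrow> carrier S" using x k dcl by (auto simp: Pi_iff)
      ultimately show ?thesis using gen[of "x(k := \<delta> (x k))" y] y by simp
    qed
    moreover have "ring_det ?C n (\<lambda>i j. if j = l then ?B i j else ?M i j) \<in> ?I"
      if l: "l \<in> {1..n}" for l
    proof -
      \<comment> \<open>Likewise, only column \<open>l\<close> involves \<open>y l\<close>.\<close>
      have "(\<lambda>i j. if j = l then ?B i j else ?M i j) = trace_matrix x (y(l := \<delta> (y l)))"
        by (intro ext) simp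
      moreover have "y(l := \<delta> (y l)) \<in> {1..n} \<rightarrow> carrier S" using y l dcl by (auto simp: Pi_iff)
      ultimately show ?thesis using gen[of x "y(l := \<delta> (y l))"] x by simp
    qed
    moreover have "\<delta> (ring_det ?C n ?M)
        = (\<Oplus>\<^bsub>?C\<^esub>k\<in>{1..n}. ring_det ?C n (\<lambda>i j. if i = k then ?A i j else ?M i j))
          \<oplus>\<^bsub>?C\<^esub> (\<Oplus>\<^bsub>?C\<^esub>l\<in>{1..n}. ring_det ?C n (\<lambda>i j. if j = l then ?B i j else ?M i j))"
      by (rule D.d_ring_det; (rule closed | rule entry); assumption)
    ultimately show ?thesis
      by (simp only:) (intro I.a_closed C.ideal_finsum_closed I.ideal_axioms, simp_all)
  qed
  then have "\<delta> ` disc_gens n \<subseteq> ?I" by blast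
  from D.d_genideal[OF G this] show ?thesis
    unfolding modified_discriminant_ideal_def .
qed

end

section \<open>Commutator identities\<close>

lemma (in abelian_group) minus_telescope:
  assumes "a \<in> carrier G" "b \<in> carrier G" "c \<in> carrier G"
  shows "(a \<ominus> b) \<oplus> (b \<ominus> c) = a \<ominus> c"
proof -
  have "(a \<ominus> b) \<oplus> (b \<ominus> c) = (a \<ominus> c) \<oplus> (b \<oplus> \<ominus> b)"
    using assms by (simp add: minus_eq a_ac del: r_neg)
  then show ?thesis using assms by (simp add: r_neg)
qed

text \<open>The Leibniz rule for the inner derivation given by \<open>z\<close>: the mixed term
  \<open>x z y\<close> is inserted and cancels.\<close>

lemma (in ring) commutator_mult:
  assumes "x \<in> carrier R" "y \<in> carrier R" "z \<in> carrier R"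
  shows "(x \<otimes> y) \<otimes> z \<ominus> z \<otimes> (x \<otimes> y)
    = x \<otimes> (y \<otimes> z \<ominus> z \<otimes> y) \<oplus> (x \<otimes> z \<ominus> z \<otimes> x) \<otimes> y"
proof -
  have "x \<otimes> (y \<otimes> z \<ominus> z \<otimes> y) = (x \<otimes> y) \<otimes> z \<ominus> (x \<otimes> z) \<otimes> y"
    using assms by (simp add: minus_eq r_distr r_minus m_assoc)
  moreover have "(x \<otimes> z \<ominus> z \<otimes> x) \<otimes> y = (x \<otimes> z) \<otimes> y \<ominus> z \<otimes> (x \<otimes> y)"
    using assms by (simp add: minus_eq l_distr l_minus m_assoc)
  ultimately show ?thesis using assms by (simp add: minus_telescope)
qed

lemma (in ring) commutator_add:
  assumes "x \<in> carrier R" "y \<in> carrier R" "z \<in> carrier R"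
  shows "(x \<oplus> y) \<otimes> z \<ominus> z \<otimes> (x \<oplus> y)
    = (x \<otimes> z \<ominus> z \<otimes> x) \<oplus> (y \<otimes> z \<ominus> z \<otimes> y)"
  using assms by (simp add: minus_eq l_distr r_distr minus_add a_ac)

section \<open>Hamiltonian derivations of the specialization\<close>

context laurent_algebra
begin

text \<open>The argument \<open>w\<close> may be non-central, where \<open>spec_bracket\<close> has
  no meaning. For this the lift \<open>c\<close> is fixed: another lift of the same central element
  would change the map by an inner derivation. The choice of the lift \<open>x\<close> of
  \<open>w\<close> does not matter, by \<open>hamiltonian_eq\<close>.\<close>

definition hamiltonian where
  "hamiltonian \<epsilon> c w = (SOME v. \<exists>x \<in> carrier R. \<exists>y \<in> carrier R.
     spec_proj K R \<epsilon> x = w \<and> q_minus K R \<epsilon> \<otimes>\<^bsub>R\<^esub> y = x \<otimes>\<^bsub>R\<^esub> c \<ominus>\<^bsub>R\<^esub> c \<otimes>\<^bsub>R\<^esub> x \<and>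
     v = spec_proj K R \<epsilon> y)"

context
  fixes \<epsilon> c
  assumes eps: "\<epsilon> \<in> carrier K"
    and reg: "regular_element R (q_minus K R \<epsilon>)"
    and c: "c \<in> carrier R"
    and center: "spec_proj K R \<epsilon> c \<in> ring_center (specialization K R \<epsilon>)"
begin

text \<open>The image of \<open>c\<close> is central, so the commutator with any \<open>x\<close>
  vanishes in the specialization, which means that it is a multiple of
  \<open>q - \<epsilon>\<close>.\<close>

lemma commutator_divisible:
  assumes x: "x \<in> carrier R"
  shows "\<exists>y \<in> carrier R. q_minus K R \<epsilon> \<otimes>\<^bsub>R\<^esub> y = x \<otimes>\<^bsub>R\<^esub> c \<ominus>\<^bsub>R\<^esub> c \<otimes>\<^bsub>R\<^esub> x"
proof -
  have "spec_proj K R \<epsilon> x \<otimes>\<^bsub>specialization K R \<epsilon>\<^esub> spec_proj K R \<epsilon> c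
      = spec_proj K R \<epsilon> c \<otimes>\<^bsub>specialization K R \<epsilon>\<^esub> spec_proj K R \<epsilon> x"
    using center x unfolding ring_center_def spec_carrier[OF eps] by blast
  then have "spec_proj K R \<epsilon> (x \<otimes>\<^bsub>R\<^esub> c) = spec_proj K R \<epsilon> (c \<otimes>\<^bsub>R\<^esub> x)"
    using ring_hom_mult[OF spec_proj_hom[OF eps]] x c by simp
  then show ?thesis
    using spec_proj_eq_iff[OF eps, of "x \<otimes>\<^bsub>R\<^esub> c" "c \<otimes>\<^bsub>R\<^esub> x"] x c by force
qed

text \<open>Well-definedness. Two lifts of the same element differ by a multiple of
  \<open>q - \<epsilon>\<close>, and their commutators with \<open>c\<close> then differ by a
  multiple of its square. After cancelling one factor, the quotients still agree modulo
  \<open>q - \<epsilon>\<close>.\<close>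

lemma hamiltonian_eq:
  assumes x: "x \<in> carrier R" and y: "y \<in> carrier R"
    and xy: "q_minus K R \<epsilon> \<otimes>\<^bsub>R\<^esub> y = x \<otimes>\<^bsub>R\<^esub> c \<ominus>\<^bsub>R\<^esub> c \<otimes>\<^bsub>R\<^esub> x"
  shows "hamiltonian \<epsilon> c (spec_proj K R \<epsilon> x) = spec_proj K R \<epsilon> y"
proof -
  let ?a = "q_minus K R \<epsilon>" and ?p = "spec_proj K R \<epsilon>"
  note a = q_minus_closed[OF eps]
  have unique: "?p y' = ?p y"
    if x': "x' \<in> carrier R" and y': "y' \<in> carrier R" and eq: "?p x' = ?p x"
      and xy': "?a \<otimes>\<^bsub>R\<^esub> y' = x' \<otimes>\<^bsub>R\<^esub> c \<ominus>\<^bsub>R\<^esub> c \<otimes>\<^bsub>R\<^esub> x'" for x' y'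
  proof -
    obtain u where u: "u \<in> carrier R" "x' \<ominus>\<^bsub>R\<^esub> x = ?a \<otimes>\<^bsub>R\<^esub> u"
      using spec_proj_eq_iff[OF eps x' x] eq by blast
    \<comment> \<open>Divisibility applied to \<open>u\<close> itself supplies the second factor
      \<open>?a\<close>.\<close>
    obtain s where s: "s \<in> carrier R" "?a \<otimes>\<^bsub>R\<^esub> s = u \<otimes>\<^bsub>R\<^esub> c \<ominus>\<^bsub>R\<^esub> c \<otimes>\<^bsub>R\<^esub> u"
      using commutator_divisible[OF u(1)] by blast
    have "x' = x \<oplus>\<^bsub>R\<^esub> ?a \<otimes>\<^bsub>R\<^esub> u"
      unfolding u(2)[symmetric] using x x' M.a_lcomm[of x x' "\<ominus>\<^bsub>R\<^esub> x"]
      by (simp add: M.minus_eq M.r_neg)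
    then have "?a \<otimes>\<^bsub>R\<^esub> y'
        = ?a \<otimes>\<^bsub>R\<^esub> y \<oplus>\<^bsub>R\<^esub> ((?a \<otimes>\<^bsub>R\<^esub> u) \<otimes>\<^bsub>R\<^esub> c \<ominus>\<^bsub>R\<^esub> c \<otimes>\<^bsub>R\<^esub> (?a \<otimes>\<^bsub>R\<^esub> u))"
      unfolding xy xy' using x c u(1) a by (simp add: M.commutator_add)
    also have "c \<otimes>\<^bsub>R\<^esub> (?a \<otimes>\<^bsub>R\<^esub> u) = ?a \<otimes>\<^bsub>R\<^esub> (c \<otimes>\<^bsub>R\<^esub> u)"
      using c u(1) a by (simp add: M.m_assoc[symmetric] q_minus_central[OF eps c])
    also have "(?a \<otimes>\<^bsub>R\<^esub> u) \<otimes>\<^bsub>R\<^esub> c \<ominus>\<^bsub>R\<^esub> ?a \<otimes>\<^bsub>R\<^esub> (c \<otimes>\<^bsub>R\<^esub> u) = ?a \<otimes>\<^bsub>R\<^esub> (?a \<otimes>\<^bsub>R\<^esub> s)"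
      unfolding s(2) using c u(1) a by (simp add: M.minus_eq M.r_distr M.r_minus M.m_assoc)
    finally have *: "?a \<otimes>\<^bsub>R\<^esub> y' = ?a \<otimes>\<^bsub>R\<^esub> (y \<oplus>\<^bsub>R\<^esub> ?a \<otimes>\<^bsub>R\<^esub> s)"
      using a y s(1) by (simp add: M.r_distr)
    let ?z = "y \<oplus>\<^bsub>R\<^esub> ?a \<otimes>\<^bsub>R\<^esub> s"
    have z: "?z \<in> carrier R" using a y s(1) by simp
    have "?a \<otimes>\<^bsub>R\<^esub> (y' \<ominus>\<^bsub>R\<^esub> ?z) = ?a \<otimes>\<^bsub>R\<^esub> y' \<ominus>\<^bsub>R\<^esub> ?a \<otimes>\<^bsub>R\<^esub> ?z"
      using a y' z by (simp add: M.minus_eq M.r_distr M.r_minus)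
    also have "\<dots> = \<zero>\<^bsub>R\<^esub>"
      unfolding * using a z by (simp add: M.minus_eq M.r_neg)
    \<comment> \<open>Regularity of \<open>?a\<close> cancels the first factor.\<close>
    finally have "y' \<ominus>\<^bsub>R\<^esub> ?z = \<zero>\<^bsub>R\<^esub>"
      using reg y' z unfolding regular_element_def by blast
    then have "y' = ?z" using y' z by simp
    then have "y' \<ominus>\<^bsub>R\<^esub> y = ?a \<otimes>\<^bsub>R\<^esub> s"
      using y s(1) a M.a_lcomm[of y "?a \<otimes>\<^bsub>R\<^esub> s" "\<ominus>\<^bsub>R\<^esub> y"]
      by (simp add: M.minus_eq M.a_assoc M.r_neg)
    then show ?thesis using spec_proj_eq_iff[OF eps y' y] s(1) by blast
  qed
  show ?thesis
    unfolding hamiltonian_def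
  proof (rule some_equality)
    show "\<exists>x'\<in>carrier R. \<exists>y'\<in>carrier R. ?p x' = ?p x \<and>
        ?a \<otimes>\<^bsub>R\<^esub> y' = x' \<otimes>\<^bsub>R\<^esub> c \<ominus>\<^bsub>R\<^esub> c \<otimes>\<^bsub>R\<^esub> x' \<and> ?p y = ?p y'"
      using x y xy by blast
  qed (use unique in blast)
qed

text \<open>Taking commutators with \<open>c\<close> is a derivation of \<open>R\<close>, and
  dividing by the central regular element \<open>q - \<epsilon>\<close> preserves its rules. For
  each rule the expected quotient is exhibited in \<open>R\<close> and passed to
  \<open>hamiltonian_eq\<close>.\<close>

lemma hamiltonian_derivation: "derivation K (specialization K R \<epsilon>) (hamiltonian \<epsilon> c)"
proof -
  let ?a = "q_minus K R \<epsilon>" and ?p = "spec_proj K R \<epsilon>" and ?S = "specialization K R \<epsilon>"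
    and ?D = "hamiltonian \<epsilon> c"
  note a = q_minus_closed[OF eps]
  note add = ring_hom_add[OF spec_proj_hom[OF eps]]
  note mult = ring_hom_mult[OF spec_proj_hom[OF eps]]
  have lift: "\<exists>x \<in> carrier R. \<exists>y \<in> carrier R. w = ?p x \<and> ?D w = ?p y \<and>
      ?a \<otimes>\<^bsub>R\<^esub> y = x \<otimes>\<^bsub>R\<^esub> c \<ominus>\<^bsub>R\<^esub> c \<otimes>\<^bsub>R\<^esub> x" if w: "w \<in> carrier ?S" for w
  proof -
    obtain x where x: "x \<in> carrier R" "w = ?p x" using w unfolding spec_carrier[OF eps] by blast
    obtain y where y: "y \<in> carrier R" "?a \<otimes>\<^bsub>R\<^esub> y = x \<otimes>\<^bsub>R\<^esub> c \<ominus>\<^bsub>R\<^esub> c \<otimes>\<^bsub>R\<^esub> x"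
      using commutator_divisible[OF x(1)] by blast
    have "?D w = ?p y" using x hamiltonian_eq[OF x(1) y] by simp
    then show ?thesis using x y by blast
  qed
  show ?thesis
    unfolding derivation_def
  proof (intro conjI ballI)
    show "?D \<in> carrier ?S \<rightarrow> carrier ?S"
      unfolding spec_carrier[OF eps]
      using lift[unfolded spec_carrier[OF eps]] by (intro Pi_I) blast
  next
    fix w w' assume w: "w \<in> carrier ?S" "w' \<in> carrier ?S"
    obtain x y where x: "x \<in> carrier R" "y \<in> carrier R" "w = ?p x" "?D w = ?p y"
      "?a \<otimes>\<^bsub>R\<^esub> y = x \<otimes>\<^bsub>R\<^esub> c \<ominus>\<^bsub>R\<^esub> c \<otimes>\<^bsub>R\<^esub> x" using lift[OF w(1)] by blast
    obtain x' y' where x': "x' \<in> carrier R" "y' \<in> carrier R" "w' = ?p x'" "?D w' = ?p y'"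
      "?a \<otimes>\<^bsub>R\<^esub> y' = x' \<otimes>\<^bsub>R\<^esub> c \<ominus>\<^bsub>R\<^esub> c \<otimes>\<^bsub>R\<^esub> x'" using lift[OF w(2)] by blast
    have "?D (?p (x \<oplus>\<^bsub>R\<^esub> x')) = ?p (y \<oplus>\<^bsub>R\<^esub> y')"
    proof (rule hamiltonian_eq)
      show "?a \<otimes>\<^bsub>R\<^esub> (y \<oplus>\<^bsub>R\<^esub> y') = (x \<oplus>\<^bsub>R\<^esub> x') \<otimes>\<^bsub>R\<^esub> c \<ominus>\<^bsub>R\<^esub> c \<otimes>\<^bsub>R\<^esub> (x \<oplus>\<^bsub>R\<^esub> x')"
        unfolding M.commutator_add[OF x(1) x'(1) c] x(5)[symmetric] x'(5)[symmetric]
        by (rule M.r_distr) (use x x' a in auto)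
    qed (use x x' in auto)
    then show "?D (w \<oplus>\<^bsub>?S\<^esub> w') = ?D w \<oplus>\<^bsub>?S\<^esub> ?D w'"
      unfolding x(4) x'(4) unfolding x(3) x'(3) using x(1,2) x'(1,2) by (simp add: add)
    \<comment> \<open>Centrality of \<open>?a\<close> lets it leave both summands of
      \<open>commutator_mult\<close>, so that the quotient for the product is the Leibniz expression
      in \<open>y\<close> and \<open>y'\<close>.\<close>
    have "x \<otimes>\<^bsub>R\<^esub> (?a \<otimes>\<^bsub>R\<^esub> y') = ?a \<otimes>\<^bsub>R\<^esub> (x \<otimes>\<^bsub>R\<^esub> y')"
      using x(1) x'(2) a by (simp add: M.m_assoc[symmetric] q_minus_central[OF eps x(1)])
    then have "?a \<otimes>\<^bsub>R\<^esub> (y \<otimes>\<^bsub>R\<^esub> x' \<oplus>\<^bsub>R\<^esub> x \<otimes>\<^bsub>R\<^esub> y')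
        = x \<otimes>\<^bsub>R\<^esub> (?a \<otimes>\<^bsub>R\<^esub> y') \<oplus>\<^bsub>R\<^esub> (?a \<otimes>\<^bsub>R\<^esub> y) \<otimes>\<^bsub>R\<^esub> x'"
      using x(1,2) x'(1,2) a by (simp add: M.r_distr M.m_assoc M.a_comm)
    then have "?D (?p (x \<otimes>\<^bsub>R\<^esub> x')) = ?p (y \<otimes>\<^bsub>R\<^esub> x' \<oplus>\<^bsub>R\<^esub> x \<otimes>\<^bsub>R\<^esub> y')"
      using x(1,2,5) x'(1,2,5) c by (intro hamiltonian_eq) (simp_all add: M.commutator_mult)
    then show "?D (w \<otimes>\<^bsub>?S\<^esub> w') = (?D w \<otimes>\<^bsub>?S\<^esub> w') \<oplus>\<^bsub>?S\<^esub> (w \<otimes>\<^bsub>?S\<^esub> ?D w')"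
      unfolding x(4) x'(4) unfolding x(3) x'(3) using x(1,2) x'(1,2) by (simp add: add mult)
  next
    fix k w assume k: "k \<in> carrier K" and w: "w \<in> carrier ?S"
    obtain x y where x: "x \<in> carrier R" "y \<in> carrier R" "w = ?p x" "?D w = ?p y"
      "?a \<otimes>\<^bsub>R\<^esub> y = x \<otimes>\<^bsub>R\<^esub> c \<ominus>\<^bsub>R\<^esub> c \<otimes>\<^bsub>R\<^esub> x" using lift[OF w] by blast
    let ?k = "laurent_const K k"
    note kc = K.laurent_const_closed[OF k]
    have neg: "?k \<odot>\<^bsub>R\<^esub> (\<ominus>\<^bsub>R\<^esub> z) = \<ominus>\<^bsub>R\<^esub> (?k \<odot>\<^bsub>R\<^esub> z)" if "z \<in> carrier R" for z
      using smult_r_minus kc that by blast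
    have "?a \<otimes>\<^bsub>R\<^esub> (?k \<odot>\<^bsub>R\<^esub> y) = ?k \<odot>\<^bsub>R\<^esub> (x \<otimes>\<^bsub>R\<^esub> c \<ominus>\<^bsub>R\<^esub> c \<otimes>\<^bsub>R\<^esub> x)"
      using x(2,5) a kc by (simp add: smult_mult_right)
    also have "\<dots> = (?k \<odot>\<^bsub>R\<^esub> x) \<otimes>\<^bsub>R\<^esub> c \<ominus>\<^bsub>R\<^esub> c \<otimes>\<^bsub>R\<^esub> (?k \<odot>\<^bsub>R\<^esub> x)"
      using x(1) c kc
      by (simp add: M.minus_eq smult_r_distr neg smult_mult_left smult_mult_right)
    finally have "?D (?p (?k \<odot>\<^bsub>R\<^esub> x)) = ?p (?k \<odot>\<^bsub>R\<^esub> y)"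
      using x(1,2) kc by (intro hamiltonian_eq) simp_all
    then show "?D (k \<odot>\<^bsub>?S\<^esub> w) = k \<odot>\<^bsub>?S\<^esub> ?D w"
      unfolding x(4) unfolding x(3) using x(1,2) by (simp add: spec_smult[OF eps k])
  qed
qed

text \<open>For central \<open>w\<close> both sides are the image of the same quotient of a
  commutator, by \<open>hamiltonian_eq\<close> and \<open>spec_bracket_eq\<close>.\<close>

lemma hamiltonian_bracket:
  assumes w: "w \<in> ring_center (specialization K R \<epsilon>)"
  shows "hamiltonian \<epsilon> c w = spec_bracket K R \<epsilon> w (spec_proj K R \<epsilon> c)"
proof -
  have "w \<in> carrier (specialization K R \<epsilon>)" using w by (simp add: ring_center_def)
  then obtain x where x: "x \<in> carrier R" "w = spec_proj K R \<epsilon> x"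
    unfolding spec_carrier[OF eps] by blast
  obtain y where y: "y \<in> carrier R" "q_minus K R \<epsilon> \<otimes>\<^bsub>R\<^esub> y = x \<otimes>\<^bsub>R\<^esub> c \<ominus>\<^bsub>R\<^esub> c \<otimes>\<^bsub>R\<^esub> x"
    using commutator_divisible[OF x(1)] by blast
  show ?thesis
    using spec_bracket_eq(2)[OF eps reg x(1) c _ center y] hamiltonian_eq[OF x(1) y] w x(2) by simp
qed

end

end

section \<open>Stability under derivations and the Poisson property\<close>

theorem theorem3p8:
  fixes K :: "'k ring" and n :: nat
  assumes "field K" and "infinite (carrier K)" and "n > 0"
  shows
    "(\<forall>(S :: ('k, 's) module) C tr.
        assoc_algebra K S \<and>
        unital_subalgebra K (center_algebra S) C \<and>
        algebra_trace S C tr \<and>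
        (\<forall>\<delta>. derivation K S \<delta> \<and> \<delta> ` C \<subseteq> C \<longrightarrow> trace_commutes_with S tr \<delta>)
        \<longrightarrow>
        (\<forall>\<delta>. derivation K S \<delta> \<and> \<delta> ` C \<subseteq> C \<longrightarrow>
           \<delta> ` modified_discriminant_ideal S C tr n \<subseteq> modified_discriminant_ideal S C tr n))
     \<and>
     (\<forall>(R :: (int \<Rightarrow> 'k, 'r) module) \<epsilon> C tr.
        assoc_algebra (laurent K) R \<and>
        \<epsilon> \<in> carrier K - {\<zero>\<^bsub>K\<^esub>} \<and>
        regular_element R (q_minus K R \<epsilon>) \<and>
        poisson_subalgebra K (center_algebra (specialization K R \<epsilon>)) (spec_bracket K R \<epsilon>) C \<and>
        algebra_trace (specialization K R \<epsilon>) C tr \<and>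
        (\<forall>\<delta>. derivation K (specialization K R \<epsilon>) \<delta> \<and> \<delta> ` C \<subseteq> C \<longrightarrow>
           trace_commutes_with (specialization K R \<epsilon>) tr \<delta>)
        \<longrightarrow>
        poisson_ideal ((specialization K R \<epsilon>)\<lparr>carrier := C\<rparr>) (spec_bracket K R \<epsilon>)
          (modified_discriminant_ideal (specialization K R \<epsilon>) C tr n) \<and>
        (\<forall>\<delta>. derivation K (specialization K R \<epsilon>) \<delta> \<and> \<delta> ` C \<subseteq> C \<longrightarrow>
           \<delta> ` modified_discriminant_ideal (specialization K R \<epsilon>) C tr n
             \<subseteq> modified_discriminant_ideal (specialization K R \<epsilon>) C tr n))"
proof (intro conjI allI impI; elim conjE)
  fix S :: "('k, 's) module" and C tr \<delta>
  assume "assoc_algebra K S" "unital_subalgebra K (center_algebra S) C" "algebra_trace S C tr"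
  then interpret trace_algebra K S C tr
    by (intro trace_algebra.intro trace_algebra_axioms.intro)
  assume "\<forall>\<delta>. derivation K S \<delta> \<and> \<delta> ` C \<subseteq> C \<longrightarrow> trace_commutes_with S tr \<delta>"
    and "derivation K S \<delta>" "\<delta> ` C \<subseteq> C"
  then show "\<delta> ` modified_discriminant_ideal S C tr n \<subseteq> modified_discriminant_ideal S C tr n"
    using derivation_disc_ideal by blast
next
  fix R :: "(int \<Rightarrow> 'k, 'r) module" and \<epsilon> C tr
  let ?S = "specialization K R \<epsilon>" and ?br = "spec_bracket K R \<epsilon>"
  let ?I = "modified_discriminant_ideal ?S C tr n"
  assume alg: "assoc_algebra (laurent K) R" and "\<epsilon> \<in> carrier K - {\<zero>\<^bsub>K\<^esub>}"
    and reg: "regular_element R (q_minus K R \<epsilon>)"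
    and poisson: "poisson_subalgebra K (center_algebra ?S) ?br C"
    and trace: "algebra_trace ?S C tr"
    and comm: "\<forall>\<delta>. derivation K ?S \<delta> \<and> \<delta> ` C \<subseteq> C \<longrightarrow> trace_commutes_with ?S tr \<delta>"
  then have eps: "\<epsilon> \<in> carrier K" by simp
  interpret R: laurent_algebra K R
    using alg assms(1) by (intro laurent_algebra.intro) (simp_all add: field_def domain_def)
  interpret S: trace_algebra K ?S C tr
    using R.spec_algebra[OF eps] poisson trace
    by (intro trace_algebra.intro trace_algebra_axioms.intro) (simp_all add: poisson_subalgebra_def)
  have stable: "\<delta> ` ?I \<subseteq> ?I" if "derivation K ?S \<delta>" "\<delta> ` C \<subseteq> C" for \<delta>
    using S.derivation_disc_ideal that comm by blast
  have "?br x z \<in> ?I" if x: "x \<in> ?I" and z: "z \<in> C" for x z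
  proof -
    have central: "z \<in> ring_center ?S" using z S.C_subset by blast
    then have "z \<in> carrier ?S" by (simp add: ring_center_def)
    \<comment> \<open>Any lift \<open>c\<close> of \<open>z\<close> will do, since on
      \<open>C\<close> the resulting derivation is the bracket with \<open>z\<close>.\<close>
    then obtain c where c: "c \<in> carrier R" "z = spec_proj K R \<epsilon> c"
      unfolding R.spec_carrier[OF eps] by blast
    note H = eps reg c(1) central[unfolded c(2)]
    have bracket: "R.hamiltonian \<epsilon> c w = ?br w z" if "w \<in> C" for w
      using R.hamiltonian_bracket[OF H] that S.C_subset c(2) by blast
    \<comment> \<open>Closure of \<open>C\<close> under the bracket makes the Hamiltonian derivation
      one of those with which the trace commutes, so that \<open>stable\<close> applies to
      it.\<close>
    have "R.hamiltonian \<epsilon> c ` C \<subseteq> C"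
      using poisson z by (auto simp: bracket poisson_subalgebra_def)
    then have "R.hamiltonian \<epsilon> c x \<in> ?I"
      using stable R.hamiltonian_derivation[OF H] x by blast
    \<comment> \<open>Membership in \<open>C\<close> allows the value of the derivation at
      \<open>x\<close> to be read as a bracket.\<close>
    moreover have "x \<in> C" using ideal.Icarr[OF S.disc_ideal x] by simp
    ultimately show ?thesis using bracket by simp
  qed
  then show "poisson_ideal (?S\<lparr>carrier := C\<rparr>) ?br ?I"
    using S.disc_ideal by (simp add: poisson_ideal_def)
next
  fix R :: "(int \<Rightarrow> 'k, 'r) module" and \<epsilon> C tr \<delta>
  let ?S = "specialization K R \<epsilon>"
  assume alg: "assoc_algebra (laurent K) R" and "\<epsilon> \<in> carrier K - {\<zero>\<^bsub>K\<^esub>}"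
    and poisson: "poisson_subalgebra K (center_algebra ?S) (spec_bracket K R \<epsilon>) C"
    and trace: "algebra_trace ?S C tr"
    and comm: "\<forall>\<delta>. derivation K ?S \<delta> \<and> \<delta> ` C \<subseteq> C \<longrightarrow> trace_commutes_with ?S tr \<delta>"
    and der: "derivation K ?S \<delta>" "\<delta> ` C \<subseteq> C"
  interpret R: laurent_algebra K R
    using alg assms(1) by (intro laurent_algebra.intro) (simp_all add: field_def domain_def)
  interpret S: trace_algebra K ?S C tr
    using R.spec_algebra \<open>\<epsilon> \<in> _\<close> poisson trace
    by (intro trace_algebra.intro trace_algebra_axioms.intro) (simp_all add: poisson_subalgebra_def)
  show "\<delta> ` modified_discriminant_ideal ?S C tr n \<subseteq> modified_discriminant_ideal ?S C tr n"
    using S.derivation_disc_ideal der comm by blast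
qed

end
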